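(* Let $q$ be a power of an odd prime. The group $\mathrm{GSp}(4,q)$ has exactly $(q^2+2q+4)(q-1)$ conjugacy classes.
   Context: $\mathrm{GSp}(4,q)$ is the group of all $g\in\mathrm{GL}(4,\mathbb F_q)$ such that ${}^tgJg=\lambda(g)J$ for some $\lambda(g)\in\mathbb F_q^\times$, where $J$ is the $4\times4$ matrix with antidiagonal entries (from top right to bottom left) $1,1,-1,-1$ and all other entries $0$. *)

theory Defs
  imports "HOL-Analysis.Determinants" "HOL-Algebra.Group_Action" "HOL-Computational_Algebra.Primes"
begin

definition symp_form :: "'a::comm_ring_1 ^ 4 ^ 4" where
  "symp_form = vector
     [vector [ 0,  0, 0, 1],
      vector [ 0,  0, 1, 0],
      vector [ 0, -1, 0, 0],
      vector [-1,  0, 0, 0]]"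

definition GSp4 :: "('a::field ^ 4 ^ 4) monoid" where
  "GSp4 = \<lparr>carrier = {g. invertible g \<and>
       (\<exists>l. l \<noteq> 0 \<and> transpose g ** symp_form ** g = (\<chi> i j. l * symp_form $ i $ j))},
     mult = (**), one = mat 1\<rparr>"

definition conjugacy_classes :: "('g, 'm) monoid_scheme \<Rightarrow> 'g set set" where
  "conjugacy_classes G =
     orbits G (carrier G) (\<lambda>g. \<lambda>h\<in>carrier G. g \<otimes>\<^bsub>G\<^esub> h \<otimes>\<^bsub>G\<^esub> inv\<^bsub>G\<^esub> g)"

lemma symp_form_nth:
  "(symp_form :: 'a::comm_ring_1 ^ 4 ^ 4) $ i $ j =
     (if i = 1 \<and> j = 4 \<or> i = 2 \<and> j = 3 then 1
      else if i = 3 \<and> j = 2 \<or> i = 4 \<and> j = 1 then -1 else 0)"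
  using exhaust_4[of i] exhaust_4[of j]
  by (elim disjE) (simp_all add: symp_form_def vector_def)

lemma scale_matrix_eq: "(\<chi> i j. l * A $ i $ j) = mat l ** (A :: 'a::comm_ring_1 ^ 'n ^ 'm)"
  by (simp add: vec_eq_iff matrix_matrix_mult_def mat_def if_distrib[of "\<lambda>x. x * y" for y] if_distrib[of "\<lambda>x. y * x" for y] cong: if_cong)

lemma mat_scale_commute: "A ** mat l = mat l ** (A :: 'a::comm_ring_1 ^ 'n ^ 'm)"
  by (simp add: vec_eq_iff matrix_matrix_mult_def mat_def if_distrib[of "\<lambda>x. x * y" for y] if_distrib[of "\<lambda>x. y * x" for y] mult.commute cong: if_cong)

lemma mat_mat: "mat a ** mat b = (mat (a * b) :: 'a::comm_ring_1 ^ 'n ^ 'n)"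
  by (simp add: vec_eq_iff matrix_matrix_mult_def mat_def if_distrib[of "\<lambda>x. x * y" for y] if_distrib[of "\<lambda>x. y * x" for y] cong: if_cong)

lemma mem_GSp4_iff:
  "g \<in> carrier GSp4 \<longleftrightarrow> invertible g \<and>
     (\<exists>l. l \<noteq> 0 \<and> transpose g ** symp_form ** g = mat l ** symp_form)"
  by (simp add: GSp4_def scale_matrix_eq)

lemma GSp4_mult: "g \<otimes>\<^bsub>GSp4\<^esub> h = g ** h"
  by (simp add: GSp4_def)

lemma GSp4_one: "\<one>\<^bsub>GSp4\<^esub> = mat 1"
  by (simp add: GSp4_def)

lemma group_GSp4: "group (GSp4 :: ('a::field ^ 4 ^ 4) monoid)"
proof (rule groupI)
  fix g h :: "'a ^ 4 ^ 4"
  assume g: "g \<in> carrier GSp4" and h: "h \<in> carrier GSp4"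
  from g obtain l where l: "l \<noteq> 0" "transpose g ** symp_form ** g = mat l ** symp_form"
    by (auto simp: mem_GSp4_iff)
  from h obtain m where m: "m \<noteq> 0" "transpose h ** symp_form ** h = mat m ** symp_form"
    by (auto simp: mem_GSp4_iff)
  have "transpose (g ** h) ** symp_form ** (g ** h)
      = transpose h ** (transpose g ** symp_form ** g) ** h"
    by (simp add: matrix_transpose_mul matrix_mul_assoc)
  also have "\<dots> = mat l ** (transpose h ** symp_form ** h)"
    unfolding l(2) by (metis mat_scale_commute matrix_mul_assoc)
  also have "\<dots> = mat (l * m) ** symp_form"
    by (simp add: m matrix_mul_assoc mat_mat)
  finally show "g \<otimes>\<^bsub>GSp4\<^esub> h \<in> carrier GSp4"
    using g h l(1) m(1) by (auto simp: mem_GSp4_iff GSp4_mult invertible_mult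
        intro!: exI[of _ "l * m"])
next
  show "\<one>\<^bsub>GSp4\<^esub> \<in> carrier (GSp4 :: ('a ^ 4 ^ 4) monoid)"
    unfolding mem_GSp4_iff
    by (auto simp: GSp4_one invertible_def transpose_mat intro!: exI[of _ "1::'a"] exI[of _ "mat 1"])
next
  fix g :: "'a ^ 4 ^ 4"
  assume g: "g \<in> carrier GSp4"
  then obtain l where l: "l \<noteq> 0" "transpose g ** symp_form ** g = mat l ** symp_form"
    by (auto simp: mem_GSp4_iff)
  obtain h where h: "g ** h = mat 1" "h ** g = mat 1"
    using g by (auto simp: mem_GSp4_iff invertible_def)
  have ht: "transpose h ** transpose g = mat 1"
    by (metis h(1) matrix_transpose_mul transpose_mat)
  have "mat l ** (transpose h ** symp_form ** h)
      = transpose h ** (transpose g ** symp_form ** g) ** h"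
    unfolding l(2) by (metis mat_scale_commute matrix_mul_assoc)
  also have "\<dots> = (transpose h ** transpose g) ** symp_form ** (g ** h)"
    by (simp add: matrix_mul_assoc)
  also have "\<dots> = symp_form"
    by (simp add: ht h)
  finally have "mat (1 / l) ** (mat l ** (transpose h ** symp_form ** h)) = mat (1 / l) ** symp_form"
    by simp
  hence "transpose h ** symp_form ** h = mat (1 / l) ** symp_form"
    using l(1) by (simp add: matrix_mul_assoc mat_mat)
  moreover have "invertible h" using h by (auto simp: invertible_def)
  ultimately have "h \<in> carrier GSp4"
    using l(1) by (auto simp: mem_GSp4_iff intro!: exI[of _ "1 / l"])
  thus "\<exists>h\<in>carrier GSp4. h \<otimes>\<^bsub>GSp4\<^esub> g = \<one>\<^bsub>GSp4\<^esub>"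
    using h by (auto simp: GSp4_mult GSp4_one intro!: bexI[of _ h])
qed (simp_all add: GSp4_mult GSp4_one matrix_mul_assoc)

lemma finite_GSp4: "finite (carrier (GSp4 :: ('a::{field, finite} ^ 4 ^ 4) monoid))"
  by (rule finite)

end

(*
  Let g have multiplier l, let g* = l g^-1 be its adjoint for the symplectic form B, and T = g + g*.
  As T is self-adjoint for an alternating form, it satisfies a quadratic equation T^2 = a T - b.

  If T is the scalar y, then N = g - y/2 satisfies N* = -N and N^2 = y^2/4 - l, and g is classified by
  the symmetric form B(u, N v).  Otherwise V is a module over K = k[T], and the coordinates of the
  K-valued form (v, g v) are s(v) = B(v, g v) and t(v) = B(v, T g v).  Put
  H(v) = t^2 - a s t + b s^2, a norm from K, so that v is a cyclic vector for g iff H(v) is nonzero.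
  If some v has s(v) = 0 and t(v) nonzero, then a, b and l determine g up to conjugacy.  Replacing v by
  (x + y T) v multiplies (s, t) by the square of x + y T in K, so such a v exists as soon as H takes
  a nonzero square value.  For cyclic g this fails only if T^2 = 4 l and all values of H
  are nonsquares or zero, which gives a single further class for each l.  If H vanishes identically,
  then g is a scalar on an eigenspace of T, or g = g*.

  The normal forms are told apart by the multiplier, the minimal polynomial, the square class of H and
  the discriminant of B(u, N v).  There are, for q - 1 multipliers or eigenvalues each,
  q^2 + 1 cyclic forms, q - 1 with cubic minimal polynomial, and (q - 1) + 1 + 1 + 3 others.
*)
theory Submission
  imports Defs "HOL-Number_Theory.Residues"
begin

section \<open>The symplectic form and similitudes\<close>

lemma vector_4 [simp]:
  "(vector [w, x, y, z] :: 'a::zero ^ 4) $ 1 = w"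
  "(vector [w, x, y, z] :: 'a ^ 4) $ 2 = x"
  "(vector [w, x, y, z] :: 'a ^ 4) $ 3 = y"
  "(vector [w, x, y, z] :: 'a ^ 4) $ 4 = z"
  by (simp_all add: vector_def)

lemma vec_4_eqI:
  "u $ 1 = v $ 1 \<Longrightarrow> u $ 2 = v $ 2 \<Longrightarrow> u $ 3 = v $ 3 \<Longrightarrow> u $ 4 = v $ 4 \<Longrightarrow> u = (v :: 'a ^ 4)"
  by (simp add: vec_eq_iff forall_4)

definition sympl :: "'a::comm_ring_1 ^ 4 \<Rightarrow> 'a ^ 4 \<Rightarrow> 'a" where
  "sympl u v = u $ 1 * v $ 4 + u $ 2 * v $ 3 - u $ 3 * v $ 2 - u $ 4 * v $ 1"

lemma sympl_add_left: "sympl (u + v) w = sympl u w + sympl v w"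
  and sympl_add_right: "sympl w (u + v) = sympl w u + sympl w v"
  and sympl_diff_left: "sympl (u - v) w = sympl u w - sympl v w"
  and sympl_diff_right: "sympl w (u - v) = sympl w u - sympl w v"
  and sympl_scale_left: "sympl (c *s u) w = c * sympl u w"
  and sympl_scale_right: "sympl w (c *s u) = c * sympl w u"
  and sympl_minus_left: "sympl (- u) w = - sympl u w"
  and sympl_minus_right: "sympl w (- u) = - sympl w u"
  by (simp_all add: sympl_def algebra_simps)

lemma sympl_zero [simp]: "sympl 0 w = 0" "sympl w 0 = 0" "sympl w w = 0"
  by (simp_all add: sympl_def algebra_simps)

lemmas sympl_linear = sympl_add_left sympl_add_right sympl_diff_left sympl_diff_right
  sympl_scale_left sympl_scale_right sympl_minus_left sympl_minus_right

lemma sympl_swap: "sympl u v = - sympl v u"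
  by (simp add: sympl_def algebra_simps)

lemma sympl_nondegenerate:
  assumes "\<And>u. sympl u v = 0"
  shows "v = 0"
proof (rule vec_4_eqI)
  show "v $ 1 = 0 $ 1" using assms[of "axis 4 1"] by (simp add: sympl_def axis_def)
  show "v $ 2 = 0 $ 2" using assms[of "axis 3 1"] by (simp add: sympl_def axis_def)
  show "v $ 3 = 0 $ 3" using assms[of "axis 2 1"] by (simp add: sympl_def axis_def)
  show "v $ 4 = 0 $ 4" using assms[of "axis 1 1"] by (simp add: sympl_def axis_def)
qed

lemma sympl_ext: "(\<And>u. sympl u v = sympl u w) \<Longrightarrow> v = w"
  using sympl_nondegenerate[of "v - w"] by (simp add: sympl_diff_right)

lemma sympl_partner:
  fixes v :: "'a::field ^ 4"
  assumes "v \<noteq> 0" obtains u where "sympl u v = c"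
proof -
  obtain u where u: "sympl u v \<noteq> 0" using assms sympl_nondegenerate by blast
  have "sympl ((c / sympl u v) *s u) v = c" using u by (simp add: sympl_scale_left)
  thus ?thesis by (rule that)
qed

lemma matrix_ext: "(\<And>v. A *v v = B *v v) \<Longrightarrow> A = (B :: 'a::comm_semiring_1 ^ 'n ^ 'm)"
  by (simp add: matrix_eq)

lemma mat_vector_mult: "mat c *v v = c *s (v :: 'a::comm_semiring_1 ^ 'n)"
  by (simp add: vec_eq_iff matrix_vector_mult_def mat_def if_distrib[of "\<lambda>x. x * y" for y] cong: if_cong)

section \<open>Similitudes and adjoints\<close>

definition similitude :: "'a::field ^ 4 ^ 4 \<Rightarrow> 'a \<Rightarrow> bool" where
  "similitude g l \<longleftrightarrow> l \<noteq> 0 \<and> (\<forall>u v. sympl (g *v u) (g *v v) = l * sympl u v)"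

text \<open>The adjoint with respect to \<^const>\<open>sympl\<close>; note that \<open>symp_form\<inverse> = - symp_form\<close>.\<close>

definition adj :: "'a::comm_ring_1 ^ 4 ^ 4 \<Rightarrow> 'a ^ 4 ^ 4" where
  "adj A = - (symp_form ** transpose A ** symp_form)"

lemma sympl_adj: "sympl (A *v u) v = sympl u (adj A *v v)"
  by (simp add: sympl_def adj_def matrix_vector_mult_def matrix_matrix_mult_def sum_4 transpose_def
      symp_form_nth algebra_simps)

lemma adj_add: "adj (A + B) = adj A + adj B"
  by (rule matrix_ext, rule sympl_ext)
    (simp flip: sympl_adj add: sympl_add_right sympl_add_left matrix_vector_mult_add_rdistrib)

lemma adj_adj [simp]: "adj (adj A) = A"
  by (rule matrix_ext, rule sympl_ext) (metis sympl_adj sympl_swap)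

text \<open>\<open>adj g ** g\<close> is minus \<open>symp_form\<close> times
  \<open>transpose g ** symp_form ** g\<close>, and \<open>symp_form\<close> cancels because its
  square is -1.\<close>

lemma similitude_iff_form:
  "(\<forall>u v. sympl (g *v u) (g *v v) = l * sympl u v) \<longleftrightarrow>
    transpose g ** symp_form ** g = mat l ** symp_form" (is "?A \<longleftrightarrow> ?B")
proof -
  have J: "symp_form *v (symp_form *v w) = - w" for w :: "'a ^ 4"
    by (rule vec_4_eqI) (simp_all add: matrix_vector_mult_def sum_4 symp_form_nth)
  have "?A \<longleftrightarrow> (\<forall>v. adj g *v (g *v v) = l *s v)"
    by (metis sympl_adj sympl_ext sympl_scale_right)
  also have "\<dots> \<longleftrightarrow> (\<forall>v. symp_form *v ((transpose g ** symp_form ** g) *v v) = symp_form *v ((mat l ** symp_form) *v v))"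
    (is "\<dots> \<longleftrightarrow> ?C")
  proof -
    have "adj g *v (g *v v) = - (symp_form *v ((transpose g ** symp_form ** g) *v v))" for v
    proof -
      have neg: "(- A) *v x = - (A *v x)" for A :: "'a ^ 4 ^ 4" and x
        by (simp add: vec_eq_iff matrix_vector_mult_def sum_negf)
      show ?thesis by (simp only: adj_def neg) (simp only: matrix_vector_mul_assoc matrix_mul_assoc)
    qed
    moreover have "symp_form *v ((mat l ** symp_form) *v v) = - (l *s v)" for v
      by (metis J mat_scale_commute mat_vector_mult matrix_vector_mul_assoc vector_smult_rneg)
    ultimately show ?thesis by (metis minus_minus)
  qed
  also have "?C \<longleftrightarrow> ?B"
    by (metis J matrix_ext minus_minus)
  finally show ?thesis .
qed

text \<open>Nondegeneracy gives the first identity. Then \<open>adj g\<close> divided by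
  \<open>l\<close> is a left inverse of a square matrix, hence a right inverse.\<close>

lemma similitude_adj:
  assumes "similitude g l"
  shows "adj g *v (g *v v) = l *s v" "g *v (adj g *v v) = l *s v"
proof -
  have l: "l \<noteq> 0" and "\<And>u v. sympl (g *v u) (g *v v) = l * sympl u v"
    using assms by (auto simp: similitude_def)
  hence 1: "adj g *v (g *v v) = l *s v" for v
    by (metis sympl_adj sympl_ext sympl_scale_right)
  show "adj g *v (g *v v) = l *s v" by (rule 1)
  have "(mat (1 / l) ** adj g) ** g = mat 1"
    by (rule matrix_ext)
      (simp flip: matrix_vector_mul_assoc add: 1 mat_vector_mult vector_smult_assoc l)
  hence 2: "g ** (mat (1 / l) ** adj g) = mat 1"
    by (simp add: matrix_left_right_inverse)
  have "g *v (adj g *v v) = l *s ((g ** (mat (1 / l) ** adj g)) *v v)"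
    by (simp flip: matrix_vector_mul_assoc add: mat_vector_mult vector_scalar_commute vector_smult_assoc l)
  thus "g *v (adj g *v v) = l *s v" by (simp add: 2)
qed

lemma mem_GSp4_iff_similitude: "g \<in> carrier GSp4 \<longleftrightarrow> (\<exists>l. similitude g l)"
proof -
  have "invertible g" if "similitude g l" for l
  proof -
    have l: "l \<noteq> 0" using that by (simp add: similitude_def)
    have "(mat (1 / l) ** adj g) ** g = mat 1"
      by (rule matrix_ext)
        (simp flip: matrix_vector_mul_assoc add: similitude_adj[OF that] mat_vector_mult vector_smult_assoc l)
    thus ?thesis by (simp add: invertible_left_inverse) blast
  qed
  thus ?thesis
    unfolding mem_GSp4_iff by (auto simp: similitude_def similitude_iff_form)
qed

text \<open>Conjugacy as an intertwining relation on vectors, which avoids inverses; the factor of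
  \<open>P\<close> is arbitrary.\<close>

definition simconj :: "'a::field ^ 4 ^ 4 \<Rightarrow> 'a ^ 4 ^ 4 \<Rightarrow> bool" where
  "simconj g h \<longleftrightarrow> (\<exists>P c. similitude P c \<and> (\<forall>v. g *v (P *v v) = P *v (h *v v)))"

lemma simconj_refl: "simconj g g"
  unfolding simconj_def by (rule exI[of _ "mat 1"], rule exI[of _ 1]) (simp add: similitude_def)

lemma simconj_iff_conjugate:
  fixes g h :: "'a::field ^ 4 ^ 4"
  assumes "h \<in> carrier GSp4"
  shows "simconj g h \<longleftrightarrow> (\<exists>P\<in>carrier GSp4. g = P \<otimes>\<^bsub>GSp4\<^esub> h \<otimes>\<^bsub>GSp4\<^esub> inv\<^bsub>GSp4\<^esub> P)"
proof -
  interpret group "GSp4 :: ('a ^ 4 ^ 4) monoid" by (rule group_GSp4)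
  have "g ** P = P ** h \<longleftrightarrow> g = P \<otimes>\<^bsub>GSp4\<^esub> h \<otimes>\<^bsub>GSp4\<^esub> inv\<^bsub>GSp4\<^esub> P" if P: "P \<in> carrier GSp4" for P
  proof -
    have r: "inv\<^bsub>GSp4\<^esub> P ** P = mat 1" "P ** inv\<^bsub>GSp4\<^esub> P = mat 1"
      using P l_inv[of P] r_inv[of P] by (simp_all add: GSp4_mult GSp4_one)
    show ?thesis unfolding GSp4_mult
      by (metis r matrix_mul_assoc matrix_mul_rid)
  qed
  thus ?thesis
    unfolding simconj_def mem_GSp4_iff_similitude Bex_def
    by (auto simp: matrix_eq matrix_vector_mul_assoc)
qed

lemma conjugacy_classes_GSp4:
  "conjugacy_classes (GSp4 :: ('a::field ^ 4 ^ 4) monoid) =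
     (\<lambda>h. {g. simconj g h}) ` carrier GSp4"
proof -
  have "orbit GSp4 (\<lambda>g. \<lambda>h\<in>carrier GSp4. g \<otimes>\<^bsub>GSp4\<^esub> h \<otimes>\<^bsub>GSp4\<^esub> inv\<^bsub>GSp4\<^esub> g) h = {g. simconj g h}"
    if "h \<in> carrier (GSp4 :: ('a ^ 4 ^ 4) monoid)" for h
    using that by (auto simp: orbit_def simconj_iff_conjugate)
  thus ?thesis
    by (auto simp: conjugacy_classes_def orbits_def)
qed

text \<open>\<open>adj P\<close> is \<open>c\<close> times the inverse of \<open>P\<close>, so it
  intertwines in the other direction.\<close>

lemma simconj_sym:
  fixes g h :: "'a::field ^ 4 ^ 4"
  assumes "simconj g h"
  shows "simconj h g"
proof -
  obtain P c where P: "similitude P c" and e: "\<And>v. g *v (P *v v) = P *v (h *v v)"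
    using assms by (auto simp: simconj_def)
  have c: "c \<noteq> 0" using P by (simp add: similitude_def)
  have "similitude (adj P) c"
    unfolding similitude_def
  proof (intro conjI allI c)
    fix u v
    show "sympl (adj P *v u) (adj P *v v) = c * sympl u v"
      by (simp add: similitude_adj[OF P] sympl_adj sympl_scale_right)
  qed
  moreover have "h *v (adj P *v v) = adj P *v (g *v v)" for v
  proof -
    have "c *s (h *v (adj P *v v)) = adj P *v (P *v (h *v (adj P *v v)))"
      by (simp add: similitude_adj[OF P])
    also have "\<dots> = adj P *v (g *v (P *v (adj P *v v)))" by (simp add: e)
    also have "\<dots> = c *s (adj P *v (g *v v))" by (simp add: similitude_adj[OF P] vector_scalar_commute)
    finally show ?thesis using c by (simp add: vec_eq_iff)
  qed
  ultimately show ?thesis unfolding simconj_def by blast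
qed

lemma simconj_trans:
  assumes "simconj g h" "simconj h k"
  shows "simconj g k"
proof -
  obtain P c where P: "similitude P c" "\<And>v. g *v (P *v v) = P *v (h *v v)"
    using assms by (auto simp: simconj_def)
  obtain Q d where Q: "similitude Q d" "\<And>v. h *v (Q *v v) = Q *v (k *v v)"
    using assms by (auto simp: simconj_def)
  have "similitude (P ** Q) (c * d)"
    using P(1) Q(1) by (simp add: similitude_def flip: matrix_vector_mul_assoc)
  moreover have "g *v ((P ** Q) *v v) = (P ** Q) *v (k *v v)" for v
    using P(2) Q(2) by (simp flip: matrix_vector_mul_assoc)
  ultimately show ?thesis unfolding simconj_def by blast
qed

section \<open>Symplectic bases up to a factor\<close>

lemma symplectic_basis:
  fixes v1 v2 v3 v4 :: "'a::field ^ 4"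
  assumes "c \<noteq> 0" "sympl v1 v4 = c" "sympl v2 v3 = c" "sympl v1 v2 = 0" "sympl v1 v3 = 0"
    "sympl v2 v4 = 0" "sympl v3 v4 = 0"
  obtains P where "similitude P c"
    "\<And>u. P *v u = u $ 1 *s v1 + u $ 2 *s v2 + u $ 3 *s v3 + u $ 4 *s v4"
proof
  define P where "P = transpose (vector [v1, v2, v3, v4] :: 'a ^ 4 ^ 4)"
  show P: "P *v u = u $ 1 *s v1 + u $ 2 *s v2 + u $ 3 *s v3 + u $ 4 *s v4" for u
    by (simp add: P_def matrix_vector_mult_def transpose_def vec_eq_iff sum_4 mult.commute)
  have sw: "sympl v4 v1 = -c" "sympl v3 v2 = -c" "sympl v2 v1 = 0" "sympl v3 v1 = 0"
    "sympl v4 v2 = 0" "sympl v4 v3 = 0"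
    using assms(2-7) sympl_swap[of v4 v1] sympl_swap[of v3 v2] sympl_swap[of v2 v1] sympl_swap[of v3 v1]
      sympl_swap[of v4 v2] sympl_swap[of v4 v3] by simp_all
  show "similitude P c"
    unfolding similitude_def P
    by (intro conjI allI assms(1))
      (simp add: sympl_linear assms(2-7) sw, simp add: sympl_def algebra_simps)
qed

text \<open>Reaching a normal form thus only requires finding suitable vectors. Their common pairing
  \<open>c\<close> need not be 1, which saves normalizing them.\<close>

lemma symplectic_basis_simconj:
  fixes g R :: "'a::field ^ 4 ^ 4"
  assumes "c \<noteq> 0" "sympl v1 v4 = c" "sympl v2 v3 = c" "sympl v1 v2 = 0" "sympl v1 v3 = 0"
    "sympl v2 v4 = 0" "sympl v3 v4 = 0"
    and "g *v v1 = R $ 1 $ 1 *s v1 + R $ 2 $ 1 *s v2 + R $ 3 $ 1 *s v3 + R $ 4 $ 1 *s v4"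
    and "g *v v2 = R $ 1 $ 2 *s v1 + R $ 2 $ 2 *s v2 + R $ 3 $ 2 *s v3 + R $ 4 $ 2 *s v4"
    and "g *v v3 = R $ 1 $ 3 *s v1 + R $ 2 $ 3 *s v2 + R $ 3 $ 3 *s v3 + R $ 4 $ 3 *s v4"
    and "g *v v4 = R $ 1 $ 4 *s v1 + R $ 2 $ 4 *s v2 + R $ 3 $ 4 *s v3 + R $ 4 $ 4 *s v4"
  shows "simconj g R"
proof -
  obtain P where "similitude P c"
    and P: "\<And>u. P *v u = u $ 1 *s v1 + u $ 2 *s v2 + u $ 3 *s v3 + u $ 4 *s v4"
    using symplectic_basis[OF assms(1-7)] by blast
  moreover have "g *v (P *v v) = P *v (R *v v)" for v
    unfolding P
    by (simp add: matrix_vector_right_distrib vector_scalar_commute assms(8-11))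
      (simp add: matrix_vector_mult_def sum_4 vec_eq_iff algebra_simps)
  ultimately show ?thesis unfolding simconj_def by blast
qed

lemma symplectic_basis_nondegenerate:
  fixes w :: "'a::field ^ 4"
  assumes "c \<noteq> 0" "sympl v1 v4 = c" "sympl v2 v3 = c" "sympl v1 v2 = 0" "sympl v1 v3 = 0"
    "sympl v2 v4 = 0" "sympl v3 v4 = 0"
    and "sympl v1 w = 0" "sympl v2 w = 0" "sympl v3 w = 0" "sympl v4 w = 0"
  shows "w = 0"
proof (rule sympl_nondegenerate)
  fix u
  obtain P where "similitude P c"
    and P: "\<And>u. P *v u = u $ 1 *s v1 + u $ 2 *s v2 + u $ 3 *s v3 + u $ 4 *s v4"
    using symplectic_basis[OF assms(1-7)] by blast
  have "c *s u = P *v (adj P *v u)" using \<open>similitude P c\<close> by (simp add: similitude_adj)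
  hence "c * sympl u w = sympl (P *v (adj P *v u)) w" by (metis sympl_scale_left)
  also have "\<dots> = 0" by (simp add: P sympl_linear assms(8-11))
  finally show "sympl u w = 0" using assms(1) by simp
qed

lemma adj_nth:
  "adj A $ i $ j = - (\<Sum>k\<in>UNIV. \<Sum>m\<in>UNIV. symp_form $ i $ k * A $ m $ k * symp_form $ m $ j)"
  by (simp add: adj_def matrix_matrix_mult_def transpose_def sum_4 algebra_simps)

text \<open>The form \<open>sympl u (A *v v)\<close> is alternating, so the characteristic
  polynomial of \<open>A\<close> is the square of a Pfaffian quadratic, which \<open>A\<close>
  already satisfies. Self-adjointness leaves six free entries, in which \<open>a\<close> and
  \<open>b\<close> are explicit.\<close>

lemma self_adjoint_quadratic:
  fixes A :: "'a::idom ^ 4 ^ 4"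
  assumes "adj A = A" and two: "(2::'a) \<noteq> 0"
  obtains a b where "\<And>v. A *v (A *v v) = a *s (A *v v) - b *s v"
proof -
  have e: "adj A $ i $ j = A $ i $ j" for i j using assms(1) by simp
  have z: "x = 0" if "- x = x" for x :: 'a
    using that two by (metis add_eq_0_iff2 mult_2 mult_eq_0_iff)
  have 1: "A $ 4 $ 4 = A $ 1 $ 1" "A $ 3 $ 3 = A $ 2 $ 2" "A $ 3 $ 4 = A $ 1 $ 2"
    "A $ 2 $ 4 = - A $ 1 $ 3" "A $ 4 $ 3 = A $ 2 $ 1" "A $ 4 $ 2 = - A $ 3 $ 1"
    using e[of 4 4] e[of 3 3] e[of 3 4] e[of 2 4] e[of 4 3] e[of 4 2]
    by (simp_all add: adj_nth symp_form_nth sum_4)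
  have 0: "A $ 1 $ 4 = 0" "A $ 2 $ 3 = 0" "A $ 3 $ 2 = 0" "A $ 4 $ 1 = 0"
    using e[of 1 4] e[of 2 3] e[of 3 2] e[of 4 1] 
    by (auto intro!: z simp: adj_nth symp_form_nth sum_4)
  show ?thesis
  proof (rule that)
    fix v
    show "A *v (A *v v) = (A $ 1 $ 1 + A $ 2 $ 2) *s (A *v v) -
       (A $ 1 $ 1 * A $ 2 $ 2 - A $ 1 $ 2 * A $ 2 $ 1 - A $ 1 $ 3 * A $ 3 $ 1) *s v"
      by (rule vec_4_eqI) (simp_all add: matrix_vector_mult_def sum_4 0 1 algebra_simps)
  qed
qed

section \<open>Squares in finite fields of odd order\<close>

lemma two_neq_zero:
  assumes "odd CARD('a::{field, finite})"
  shows "(2::'a) \<noteq> 0"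
proof
  assume "(2::'a) = 0"
  hence "of_nat 2 = (0::'a)" by simp
  hence "CHAR('a) dvd 2" by (simp only: of_nat_eq_0_iff_char_dvd)
  moreover have "CHAR('a) \<noteq> 1" using of_nat_CHAR[where 'a = 'a] by (metis of_nat_1 zero_neq_one)
  ultimately have "CHAR('a) = 2" by (metis prime_nat_iff two_is_prime_nat)
  thus False using CHAR_dvd_CARD[where 'a = 'a] assms by simp
qed

definition is_square :: "'a::monoid_mult \<Rightarrow> bool" where
  "is_square x \<longleftrightarrow> (\<exists>y. x = y * y)"

text \<open>The fibres of squaring have at most two elements.\<close>

lemma card_le_twice_squares:
  fixes X :: "'a::{field, finite} set"
  shows "card X \<le> 2 * card ((\<lambda>x. x * x) ` X)"
proof -
  let ?S = "(\<lambda>x. x * x) ` X"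
  have "card X \<le> card (\<Union>y\<in>?S. {x\<in>X. x * x = y})"
    by (rule card_mono) auto
  also have "\<dots> \<le> (\<Sum>y\<in>?S. card {x\<in>X. x * x = y})"
    by (rule card_UN_le) simp
  also have "\<dots> \<le> (\<Sum>y\<in>?S. 2)"
  proof (rule sum_mono)
    fix y assume "y \<in> ?S"
    then obtain z where "y = z * z" by auto
    hence "{x\<in>X. x * x = y} \<subseteq> {z, - z}" by (auto simp: square_eq_iff)
    hence "card {x\<in>X. x * x = y} \<le> card {z, - z}" by (rule card_mono[rotated]) simp
    also have "\<dots> \<le> 2" by (simp add: card_insert_if)
    finally show "card {x\<in>X. x * x = y} \<le> 2" .
  qed
  finally show ?thesis by (simp add: mult.commute)
qed

lemma ex_nonsquare:
  assumes "(2::'a::{field, finite}) \<noteq> 0"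
  shows "\<exists>e::'a. \<not> is_square e"
proof (rule ccontr)
  assume "\<not> ?thesis"
  hence "surj (\<lambda>x::'a. x * x)" by (auto simp: is_square_def surj_def)
  hence "inj (\<lambda>x::'a. x * x)" by (simp add: finite_UNIV_surj_inj)
  hence "(1::'a) = - 1" by (rule injD) simp
  thus False using assms by (metis add.right_inverse one_add_one)
qed

text \<open>Let S be the set of nonzero squares, at least half of the nonzero elements. S is
  disjoint from \<open>a\<close> S and from \<open>b\<close> S, so these two sets must meet for lack
  of room.\<close>

lemma nonsquare_mult:
  fixes a b :: "'a::{field, finite}"
  assumes "\<not> is_square a" "\<not> is_square b"
  shows "is_square (a * b)"
proof -
  let ?S = "(\<lambda>x. x * x) ` (- {0::'a})"
  have nz: "a \<noteq> 0" "b \<noteq> 0" using assms by (auto simp: is_square_def)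
  have i: "card ((*) c ` ?S) = card ?S" if "c \<noteq> 0" for c
    by (rule card_image) (use that in \<open>auto simp: inj_on_def\<close>)
  have d: "?S \<inter> (*) c ` ?S = {}" if "\<not> is_square c" for c
  proof (rule ccontr)
    assume "?S \<inter> (*) c ` ?S \<noteq> {}"
    then obtain x y where "x * x = c * (y * y)" "y \<noteq> 0" by auto
    hence "c = (x / y) * (x / y)" by (simp add: field_simps)
    thus False using that unfolding is_square_def by blast
  qed
  have "(*) a ` ?S \<inter> (*) b ` ?S \<noteq> {}"
  proof
    assume e: "(*) a ` ?S \<inter> (*) b ` ?S = {}"
    have "card (?S \<union> ((*) a ` ?S \<union> (*) b ` ?S)) = card ?S + (card ?S + card ?S)"
      using d[OF assms(1)] d[OF assms(2)] e i[OF nz(1)] i[OF nz(2)]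
      by (subst card_Un_disjoint; simp add: Int_Un_distrib card_Un_disjoint)
    moreover have "card (?S \<union> ((*) a ` ?S \<union> (*) b ` ?S)) \<le> card (- {0::'a})"
      by (rule card_mono) (use nz in auto)
    moreover have "card (- {0::'a}) \<le> 2 * card ?S" by (rule card_le_twice_squares)
    moreover have "card ?S > 0" 
    proof -
      have "1 \<in> - {0::'a}" by simp
      hence "?S \<noteq> {}" by blast
      thus ?thesis by (simp only: card_gt_0_iff finite) simp
    qed
    ultimately show False by linarith
  qed
  then obtain x y where "a * (x * x) = b * (y * y)" "x \<noteq> 0" by auto
  hence "a * b = (b * y / x) * (b * y / x)" by (simp add: field_simps)
  thus ?thesis unfolding is_square_def by blast
qed

text \<open>Pigeonhole: the values of a x^2 and those of c - b y^2 each fill more than half of the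
  field.\<close>

lemma diagonal_form_universal:
  fixes a b :: "'a::{field, finite}"
  assumes "a \<noteq> 0" "b \<noteq> 0"
  obtains x y where "a * (x * x) + b * (y * y) = c"
proof -
  let ?S = "range (\<lambda>x::'a. x * x)" and ?S' = "(\<lambda>x::'a. x * x) ` (- {0})"
  let ?A = "(\<lambda>s. a * s) ` ?S" and ?B = "(\<lambda>s. c - b * s) ` ?S"
  have AB: "card ?A = card ?S" "card ?B = card ?S"
    using assms by (auto intro!: card_image simp: inj_on_def)
  have "?S = insert 0 ?S'" "0 \<notin> ?S'" by force+
  hence "card ?S = Suc (card ?S')" by simp
  moreover have "card (- {0::'a}) \<le> 2 * card ?S'" by (rule card_le_twice_squares)
  moreover have "card (- {0::'a}) = CARD('a) - 1" by (simp add: Compl_eq_Diff_UNIV)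
  ultimately have "CARD('a) < 2 * card ?S" by simp
  moreover have "card (?A \<union> ?B) \<le> CARD('a)" by (rule card_mono) auto
  ultimately have "?A \<inter> ?B \<noteq> {}"
    using AB card_Un_disjoint[of ?A ?B] by force
  then obtain x y where "a * (x * x) = c - b * (y * y)" by auto
  thus ?thesis using that[of x y] by (simp add: algebra_simps)
qed

text \<open>Completing the square turns \<open>a\<close> times the form into (a x + b y)^2 + (a c -
  b^2) y^2. For \<open>a = 0\<close> the equation is linear in x once y = 1.\<close>

lemma binary_form_universal:
  fixes a b c :: "'a::{field, finite}"
  assumes "b * b - a * c \<noteq> 0" "(2::'a) \<noteq> 0"
  obtains x y where "a * (x * x) + 2 * b * (x * y) + c * (y * y) = k"
proof (cases "a = 0")
  case True
  hence "b \<noteq> 0" using assms by simp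
  hence "a * (((k - c) / (2 * b)) * ((k - c) / (2 * b))) + 2 * b * ((k - c) / (2 * b) * 1) + c * (1 * 1) = k"
    using True assms(2) by simp
  thus ?thesis by (rule that)
next
  case False
  obtain x y where xy: "1 * (x * x) + (a * c - b * b) * (y * y) = a * k"
    using diagonal_form_universal[of 1 "a * c - b * b" "a * k"] assms(1) by auto
  have "a * (a * (((x - b * y) / a) * ((x - b * y) / a)) + 2 * b * ((x - b * y) / a * y) + c * (y * y))
      = (x - b * y) * (x - b * y) + 2 * b * (x - b * y) * y + a * c * (y * y)"
    using False by (simp add: field_simps)
  also have "\<dots> = 1 * (x * x) + (a * c - b * b) * (y * y)" by (simp add: algebra_simps)
  finally have "a * (((x - b * y) / a) * ((x - b * y) / a)) + 2 * b * ((x - b * y) / a * y) + c * (y * y) = k"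
    using False xy by simp
  thus ?thesis by (rule that)
qed

section \<open>Normal forms\<close>

text \<open>The matrix of \<open>g\<close> in the basis \<open>v, g v, (g\<^sup>3 v - a g\<^sup>2 v) / l, g\<^sup>2 v\<close>, where
  \<open>g\<close> has characteristic polynomial \<open>x\<^sup>4 - a x\<^sup>3 + b x\<^sup>2 - l a x + l\<^sup>2\<close> and \<open>B(v, g v) = 0\<close>.\<close>

definition cyclic_form :: "'a::field \<Rightarrow> 'a \<Rightarrow> 'a \<Rightarrow> 'a ^ 4 ^ 4" where
  "cyclic_form l a b = vector [vector [0, 0, -l, 0], vector [1, 0, a, 0], vector [0, 0, 0, l],
     vector [0, 1, - (b / l), a]]"

text \<open>The sum \<open>C + M\<close> of the self-adjoint \<open>C = root_form l 0 0\<close> with \<open>C\<^sup>2 = l\<close> and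
  of a skew-adjoint \<open>M\<close> commuting with \<open>C\<close> such that \<open>M\<^sup>2 = 0\<close>; for the first basis vector \<open>v\<close>,
  \<open>B(v, M v) = s\<close> and \<open>B(v, C M v) = r\<close>.\<close>

definition root_form :: "'a::field \<Rightarrow> 'a \<Rightarrow> 'a \<Rightarrow> 'a ^ 4 ^ 4" where
  "root_form l s r = vector [vector [0, l, 0, 0], vector [1, 0, 0, 0], vector [r, l * s, 0, l],
     vector [s, r, 1, 0]]"

text \<open>The orthogonal sum of the scalar \<open>m\<close> on the middle two basis vectors and a
  block with polynomial x^2 - y x + m^2 on the outer two.\<close>

definition cubic_form :: "'a::field \<Rightarrow> 'a \<Rightarrow> 'a ^ 4 ^ 4" where
  "cubic_form m y = vector [vector [0, 0, 0, - (m * m)], vector [0, m, 0, 0], vector [0, 0, m, 0],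
     vector [1, 0, 0, y]]"

text \<open>For \<open>N = quadratic_form h d k - h\<close> the basis is \<open>e, f, w, N e\<close> with \<open>N f = k w\<close>;
  this is a similitude only if \<open>d = 0\<close> or \<open>k = 1\<close>.\<close>

definition quadratic_form :: "'a::field \<Rightarrow> 'a \<Rightarrow> 'a \<Rightarrow> 'a ^ 4 ^ 4" where
  "quadratic_form h d k = vector [vector [h, 0, 0, d], vector [0, h, d, 0], vector [0, k, h, 0],
     vector [1, 0, 0, h]]"

lemma matrix_4_vector_mult:
  fixes v :: "'a::comm_semiring_1 ^ 4"
  shows "(vector [r1, r2, r3, r4] :: 'a ^ 4 ^ 4) *v v =
    vector [r1 $ 1 * v $ 1 + r1 $ 2 * v $ 2 + r1 $ 3 * v $ 3 + r1 $ 4 * v $ 4,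
      r2 $ 1 * v $ 1 + r2 $ 2 * v $ 2 + r2 $ 3 * v $ 3 + r2 $ 4 * v $ 4,
      r3 $ 1 * v $ 1 + r3 $ 2 * v $ 2 + r3 $ 3 * v $ 3 + r3 $ 4 * v $ 4,
      r4 $ 1 * v $ 1 + r4 $ 2 * v $ 2 + r4 $ 3 * v $ 3 + r4 $ 4 * v $ 4]"
  by (rule vec_4_eqI) (simp_all add: matrix_vector_mult_def sum_4)

lemma cyclic_form_mult: "cyclic_form l a b *v v =
    vector [- l * v $ 3, v $ 1 + a * v $ 3, l * v $ 4, v $ 2 - b / l * v $ 3 + a * v $ 4]"
  and root_form_mult: "root_form l s r *v v =
    vector [l * v $ 2, v $ 1, r * v $ 1 + l * s * v $ 2 + l * v $ 4, s * v $ 1 + r * v $ 2 + v $ 3]"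
  and cubic_form_mult: "cubic_form m y *v v =
    vector [- (m * m) * v $ 4, m * v $ 2, m * v $ 3, v $ 1 + y * v $ 4]"
  and quadratic_form_mult: "quadratic_form h d k *v v =
    vector [h * v $ 1 + d * v $ 4, h * v $ 2 + d * v $ 3, k * v $ 2 + h * v $ 3, v $ 1 + h * v $ 4]"
  by (simp_all add: cyclic_form_def root_form_def cubic_form_def quadratic_form_def matrix_4_vector_mult)

lemmas form_mult = cyclic_form_mult root_form_mult cubic_form_mult quadratic_form_mult

definition nonsquare :: "'a::field" where
  "nonsquare = (SOME e. \<not> is_square e)"

text \<open>For \<open>root_form l 1 r\<close> every value of \<open>H\<close> is a square times
  \<open>r * r - l\<close>, so this choice of \<open>r\<close> makes all of them nonsquare or
  zero.\<close>

definition twist :: "'a::field \<Rightarrow> 'a" where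
  "twist l = (SOME r. \<not> is_square (r * r - l))"

lemma nonsquare: "(2::'a::{field, finite}) \<noteq> 0 \<Longrightarrow> \<not> is_square (nonsquare :: 'a)"
  unfolding nonsquare_def by (rule someI_ex) (rule ex_nonsquare)

text \<open>The form x^2 - l y^2 represents a nonsquare; there y is nonzero, and dividing by y^2
  gives the parameter.\<close>

lemma twist:
  assumes "(2::'a::{field, finite}) \<noteq> 0" "l \<noteq> 0"
  shows "\<not> is_square (twist l * twist l - (l::'a))"
  unfolding twist_def
proof (rule someI_ex)
  obtain x y where xy: "1 * (x * x) + (- l) * (y * y) = (nonsquare :: 'a)"
    using diagonal_form_universal[of 1 "- l" nonsquare] assms by auto
  have y: "y \<noteq> 0"
    using xy nonsquare[OF assms(1)] unfolding is_square_def by (metis add_0_right mult_1 mult_zero_right)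
  define r where "r = x / y"
  have r: "nonsquare = (r * r - l) * (y * y)"
  proof -
    have "x = r * y" using y by (simp add: r_def)
    thus ?thesis using xy by (simp add: algebra_simps)
  qed
  have "\<not> is_square (r * r - l)"
  proof
    assume "is_square (r * r - l)"
    then obtain z where "r * r - l = z * z" by (auto simp: is_square_def)
    hence "nonsquare = (z * y) * (z * y)" by (simp add: r algebra_simps)
    thus False using nonsquare[OF assms(1)] unfolding is_square_def by blast
  qed
  thus "\<exists>r. \<not> is_square (r * r - l)" by blast
qed

text \<open>For valid parameters, the first two kinds have a cyclic vector, \<open>Cubic\<close> is
  scalar on one eigenspace of the trace T, \<open>Root\<close> is self-adjoint, and T is scalar for
  the last three.\<close>

datatype 'a class_index = Cyclic 'a 'a 'a | Twisted 'a | Cubic 'a 'a | Root 'a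
  | Semisimple 'a 'a | Scalar 'a | Nilpotent 'a 'a

primrec rep :: "'a::field class_index \<Rightarrow> 'a ^ 4 ^ 4" where
  "rep (Cyclic l a b) = cyclic_form l a b"
| "rep (Twisted l) = root_form l 1 (twist l)"
| "rep (Cubic m y) = cubic_form m y"
| "rep (Root l) = root_form l 0 0"
| "rep (Semisimple h d) = quadratic_form h d 1"
| "rep (Scalar h) = mat h"
| "rep (Nilpotent h k) = quadratic_form h 0 k"

primrec multiplier :: "'a::field class_index \<Rightarrow> 'a" where
  "multiplier (Cyclic l a b) = l"
| "multiplier (Twisted l) = l"
| "multiplier (Cubic m y) = m * m"
| "multiplier (Root l) = l"
| "multiplier (Semisimple h d) = h * h - d"
| "multiplier (Scalar h) = h * h"
| "multiplier (Nilpotent h k) = h * h"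

text \<open>For \<open>y = 2 * m\<close> the minimal polynomial of \<open>cubic_form m y\<close>
  would drop to (x - m)^2. The values of \<open>k\<close> record the rank and the square class of a
  symmetric form.\<close>

primrec valid :: "'a::field class_index \<Rightarrow> bool" where
  "valid (Cyclic l a b) \<longleftrightarrow> l \<noteq> 0"
| "valid (Twisted l) \<longleftrightarrow> l \<noteq> 0"
| "valid (Cubic m y) \<longleftrightarrow> m \<noteq> 0 \<and> y \<noteq> 2 * m"
| "valid (Root l) \<longleftrightarrow> l \<noteq> 0"
| "valid (Semisimple h d) \<longleftrightarrow> d \<noteq> 0 \<and> d \<noteq> h * h"
| "valid (Scalar h) \<longleftrightarrow> h \<noteq> 0"
| "valid (Nilpotent h k) \<longleftrightarrow> h \<noteq> 0 \<and> k \<in> {0, 1, nonsquare}"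

lemma similitude_rep: "valid x \<Longrightarrow> similitude (rep x) (multiplier x)"
  by (cases x) (auto simp: similitude_def form_mult sympl_def mat_vector_mult field_simps)

subsection \<open>Distinct normal forms are not conjugate\<close>

lemma similitude_inj: "similitude P c \<Longrightarrow> P *v v = P *v w \<Longrightarrow> v = w"
  by (metis similitude_adj(1) similitude_def vector_mul_lcancel)

lemma simconj_similitude:
  assumes "simconj g h" "similitude g l"
  shows "similitude h l"
proof -
  obtain P c where P: "similitude P c" and e: "\<And>v. g *v (P *v v) = P *v (h *v v)"
    using assms by (auto simp: simconj_def)
  have "c * sympl (h *v u) (h *v v) = c * (l * sympl u v)" for u v
  proof -
    have "c * sympl (h *v u) (h *v v) = sympl (P *v (h *v u)) (P *v (h *v v))"
      using P by (simp add: similitude_def)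
    also have "\<dots> = l * sympl (P *v u) (P *v v)"
      using assms(2) by (simp add: similitude_def flip: e)
    finally show ?thesis using P by (simp add: similitude_def)
  qed
  thus ?thesis using P assms(2) by (simp add: similitude_def)
qed

lemma similitude_unique:
  assumes "similitude g l" "similitude g m"
  shows "l = m"
proof -
  have "sympl (axis 1 1) (axis 4 (1::'a)) = 1" by (simp add: sympl_def axis_def)
  thus ?thesis using assms unfolding similitude_def by (metis mult.right_neutral)
qed

section \<open>Annihilating polynomials as invariants\<close>

definition cubic_relation :: "'a::field ^ 4 ^ 4 \<Rightarrow> 'a \<Rightarrow> 'a \<Rightarrow> 'a \<Rightarrow> 'a \<Rightarrow> bool" where
  "cubic_relation g p q r s \<longleftrightarrow>
     (\<forall>v. p *s (g *v (g *v (g *v v))) + q *s (g *v (g *v v)) + r *s (g *v v) + s *s v = 0)"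

lemma cubic_relation_simconj:
  assumes "simconj g h" "cubic_relation g p q r s"
  shows "cubic_relation h p q r s"
proof -
  obtain P c where P: "similitude P c" and e: "\<And>v. g *v (P *v v) = P *v (h *v v)"
    using assms by (auto simp: simconj_def)
  have "P *v (p *s (h *v (h *v (h *v v))) + q *s (h *v (h *v v)) + r *s (h *v v) + s *s v) = P *v 0" for v
    using assms(2) by (simp add: cubic_relation_def matrix_vector_right_distrib vector_scalar_commute flip: e)
  thus ?thesis unfolding cubic_relation_def using similitude_inj[OF P] by blast
qed

definition quartic_relation :: "'a::field ^ 4 ^ 4 \<Rightarrow> 'a \<Rightarrow> 'a \<Rightarrow> 'a \<Rightarrow> 'a \<Rightarrow> bool" where
  "quartic_relation g p q r s \<longleftrightarrow>
     (\<forall>v. g *v (g *v (g *v (g *v v))) =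
        p *s (g *v (g *v (g *v v))) + q *s (g *v (g *v v)) + r *s (g *v v) + s *s v)"

lemma quartic_relation_simconj:
  assumes "simconj g h" "quartic_relation g p q r s"
  shows "quartic_relation h p q r s"
proof -
  obtain P c where P: "similitude P c" and e: "\<And>v. g *v (P *v v) = P *v (h *v v)"
    using assms by (auto simp: simconj_def)
  have "P *v (h *v (h *v (h *v (h *v v)))) =
     P *v (p *s (h *v (h *v (h *v v))) + q *s (h *v (h *v v)) + r *s (h *v v) + s *s v)" for v
    using assms(2) by (simp add: quartic_relation_def matrix_vector_right_distrib vector_scalar_commute flip: e)
  thus ?thesis unfolding quartic_relation_def using similitude_inj[OF P] by blast
qed

lemma quartic_relation_unique:
  assumes "quartic_relation g p q r s" "quartic_relation g p' q' r' s'"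
  shows "cubic_relation g (p - p') (q - q') (r - r') (s - s')"
  using assms unfolding quartic_relation_def cubic_relation_def
  by (simp add: vec_eq_iff algebra_simps)

lemma cubic_relation_diff:
  assumes "cubic_relation g p q r s" "cubic_relation g p q' r' s'"
  shows "cubic_relation g 0 (q - q') (r - r') (s - s')"
  unfolding cubic_relation_def
proof
  fix v
  have "(p *s (g *v (g *v (g *v v))) + q *s (g *v (g *v v)) + r *s (g *v v) + s *s v) -
    (p *s (g *v (g *v (g *v v))) + q' *s (g *v (g *v v)) + r' *s (g *v v) + s' *s v) = 0"
    using assms by (simp only: cubic_relation_def) simp
  thus "0 *s (g *v (g *v (g *v v))) + (q - q') *s (g *v (g *v v)) + (r - r') *s (g *v v) + (s - s') *s v = 0"
    by (simp add: vec_eq_iff algebra_simps)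
qed

primrec min_degree :: "'a class_index \<Rightarrow> nat" where
  "min_degree (Cyclic l a b) = 4"
| "min_degree (Twisted l) = 4"
| "min_degree (Cubic m y) = 3"
| "min_degree (Root l) = 2"
| "min_degree (Semisimple h d) = 2"
| "min_degree (Scalar h) = 1"
| "min_degree (Nilpotent h k) = 2"

text \<open>The first basis vector is cyclic.\<close>

lemma cubic_relation_cyclic:
  assumes "cubic_relation (cyclic_form l a b) p q r s" "l \<noteq> 0"
  shows "p = 0 \<and> q = 0 \<and> r = 0 \<and> s = 0"
  using assms spec[OF assms(1)[unfolded cubic_relation_def], of "vector [1, 0, 0, 0]"]
  by (auto simp: form_mult vec_eq_iff forall_4)

text \<open>Evaluation at the first basis vector gives four linear equations. Two of them eliminate
  \<open>r\<close> and \<open>s\<close>; the other two then have determinant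
  \<open>t * t - l\<close> up to a nonzero factor.\<close>

lemma cubic_relation_twisted:
  assumes "cubic_relation (root_form l 1 t) p q r s" "l \<noteq> 0" "t * t \<noteq> l" "(2::'a::field) \<noteq> 0"
  shows "p = (0::'a) \<and> q = 0 \<and> r = 0 \<and> s = 0"
proof -
  have 1: "l * q + s = 0" "l * p + r = 0" "3 * l * t * p + 2 * l * q + t * r = 0"
     "3 * l * p + 2 * t * q + r = 0"
    using spec[OF assms(1)[unfolded cubic_relation_def], of "vector [1, 0, 0, 0]"]
    by (simp_all add: form_mult vec_eq_iff forall_4 algebra_simps)
  have s: "s = - (l * q)" and r: "r = - (l * p)"
    using 1(1,2) by (simp_all add: eq_neg_iff_add_eq_0 add.commute)
  have "2 * l * (t * p + q) = 3 * l * t * p + 2 * l * q + t * r"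
    "2 * (l * p + t * q) = 3 * l * p + 2 * t * q + r"
    by (simp_all add: r algebra_simps)
  hence "t * p + q = 0" "l * p + t * q = 0"
    using assms 1 by (metis mult_eq_0_iff)+
  hence "q = - t * p" "l * p + t * q = 0"
    by (simp_all add: eq_neg_iff_add_eq_0 add.commute)
  hence "(l - t * t) * p = 0" by (simp add: algebra_simps)
  thus ?thesis using assms(3) s r \<open>q = - t * p\<close> by simp
qed

lemma cubic_relation_cubic:
  assumes "cubic_relation (cubic_form m y) 0 q r s" "m \<noteq> 0" "y \<noteq> 2 * m"
  shows "q = 0 \<and> r = 0 \<and> s = 0"
proof -
  have 1: "s = m * m * q" "q * y + r = 0" "q * m * m + r * m + s = 0"
    using spec[OF assms(1)[unfolded cubic_relation_def], of "vector [1, 0, 0, 0]"]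
      spec[OF assms(1)[unfolded cubic_relation_def], of "vector [0, 1, 0, 0]"]
    by (simp_all add: form_mult vec_eq_iff forall_4 algebra_simps)
  hence "r = - q * y" by (simp add: eq_neg_iff_add_eq_0 add.commute)
  hence "m * q * (2 * m - y) = 0" using 1 by (simp add: algebra_simps)
  thus ?thesis using 1 assms by auto
qed

lemma not_linear_relation:
  assumes "cubic_relation (rep x) 0 0 r s" "valid x" "(2::'a::{field,finite}) \<noteq> 0" "min_degree x \<ge> 2"
  shows "r = (0::'a) \<and> s = 0"
  using assms spec[OF assms(1)[unfolded cubic_relation_def], of "vector [1, 0, 0, 0]"]
  by (cases x) (auto simp: form_mult vec_eq_iff forall_4)

text \<open>Each case exhibits the minimal polynomial of \<open>rep x\<close>, which must also
  annihilate \<open>rep y\<close>.\<close>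

lemma simconj_min_degree_le:
  assumes "simconj (rep x) (rep y)" "valid x" "valid y" "(2::'a::{field,finite}) \<noteq> 0"
  shows "min_degree (y :: 'a class_index) \<le> min_degree x"
proof (rule ccontr)
  assume less: "\<not> ?thesis"
  \<comment> \<open>Polynomials of degree below \<open>min_degree y\<close> that annihilate
    \<open>rep x\<close>, and therefore \<open>rep y\<close>, are zero.\<close>
  have big: "p = 0 \<and> q = 0 \<and> r = 0 \<and> s = 0"
    if "cubic_relation (rep x) p q r s" "min_degree y \<le> 3 \<longrightarrow> p = 0" "min_degree y \<le> 2 \<longrightarrow> q = 0" for p q r s
  proof -
    have rel: "cubic_relation (rep y) p q r s" using cubic_relation_simconj assms that by blast
    show ?thesis
    proof (cases y)
      case (Cyclic l a b)
      thus ?thesis using rel assms(3) cubic_relation_cyclic[of l a b p q r s] by simp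
    next
      case (Twisted l)
      have "twist l * twist l \<noteq> l"
        using twist[OF assms(4), of l] assms(3) Twisted by (auto simp: is_square_def)
      thus ?thesis using rel assms(3,4) cubic_relation_twisted[of l "twist l" p q r s] Twisted by simp
    next
      case (Cubic m z)
      thus ?thesis using rel assms(3) cubic_relation_cubic[of m z q r s] that by simp
    next
      case (Scalar h)
      thus ?thesis using less by (cases x) auto
    qed (use rel not_linear_relation[of y r s] assms that in auto)
  qed
  have "min_degree y \<le> 4" by (cases y) auto
  thus False
  proof (cases x)
    case (Cubic m z)
    have "cubic_relation (rep x) 1 (- (m + z)) (m * m + m * z) (- (m * m * m))"
      by (simp add: Cubic cubic_relation_def form_mult vec_eq_iff forall_4 algebra_simps)
    from big[OF this] show False using Cubic less by simp
  next
    case (Root l)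
    have "cubic_relation (rep x) 0 1 0 (- l)"
      by (simp add: Root cubic_relation_def form_mult vec_eq_iff forall_4 algebra_simps)
    thus False using big Root less by fastforce
  next
    case (Semisimple h d)
    have "cubic_relation (rep x) 0 1 (- 2 * h) (h * h - d)"
      by (simp add: Semisimple cubic_relation_def form_mult vec_eq_iff forall_4 algebra_simps)
    thus False using big Semisimple less by fastforce
  next
    case (Scalar h)
    have "cubic_relation (rep x) 0 0 1 (- h)"
      by (simp add: Scalar cubic_relation_def mat_vector_mult vec_eq_iff)
    thus False using big Scalar less by fastforce
  next
    case (Nilpotent h k)
    have "cubic_relation (rep x) 0 1 (- 2 * h) (h * h)"
      by (simp add: Nilpotent cubic_relation_def form_mult vec_eq_iff forall_4 algebra_simps)
    thus False using big Nilpotent less by fastforce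
  qed (use less in auto)
qed

section \<open>Invariants finer than the minimal polynomial\<close>

lemma cyclic_not_simconj_twisted:
  assumes "(2::'a::{field,finite}) \<noteq> 0" "\<not> is_square (t * t - l)"
  shows "\<not> simconj (root_form l 1 t) (cyclic_form l 0 (- 2 * l) :: 'a ^ 4 ^ 4)"
proof
  let ?g = "root_form l 1 t" and ?h = "cyclic_form l 0 (- 2 * l)"
  assume "simconj ?g ?h"
  then obtain P c where P: "similitude P c" and e: "\<And>v. ?g *v (P *v v) = P *v (?h *v v)"
    by (auto simp: simconj_def)
  define w where "w = P *v (vector [1, 0, 0, 0])"
  have c: "c \<noteq> 0" using P by (simp add: similitude_def)
  have "sympl w (?g *v w) = c * sympl (vector [1, 0, 0, 0]) (?h *v vector [1, 0, 0, 0])"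
    using P by (simp add: w_def e similitude_def)
  hence s: "sympl w (?g *v w) = 0" by (simp add: form_mult sympl_def)
  have "sympl w (?g *v (?g *v w)) = c * sympl (vector [1, 0, 0, 0]) (?h *v (?h *v vector [1, 0, 0, 0]))"
    using P by (simp add: w_def e similitude_def)
  hence r: "sympl w (?g *v (?g *v w)) = c" by (simp add: form_mult sympl_def)
  \<comment> \<open>The next identity computes \<open>H\<close> at \<open>w\<close> as a square
    times \<open>t * t - l\<close>. Since \<open>w\<close> comes from a vector with
    \<open>s = 0\<close>, the same value is \<open>c * c\<close>.\<close>
  define z where "z = 2 * (w $ 1 * w $ 1 - l * (w $ 2 * w $ 2))"
  have "sympl w (?g *v (?g *v w)) * sympl w (?g *v (?g *v w)) - 4 * l * (sympl w (?g *v w) * sympl w (?g *v w))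
     = z * z * (t * t - l)"
    unfolding z_def by (simp add: form_mult sympl_def) (simp add: algebra_simps)
  hence eq: "c * c = z * z * (t * t - l)" by (simp add: s r)
  hence "z \<noteq> 0" using c by auto
  hence "t * t - l = (c / z) * (c / z)" using eq by (simp add: field_simps)
  thus False using assms(2) unfolding is_square_def by blast
qed

text \<open>\<open>S\<close> is the symmetric form B(u, N v), diagonal with entries 1 and
  \<open>k\<close>. Conjugation rescales it by \<open>c\<close>, and \<open>z\<close> is the minor
  that relates the Gram determinants.\<close>

lemma simconj_nilpotent:
  assumes "simconj (quadratic_form h 0 k) (quadratic_form h 0 k' :: 'a::field ^ 4 ^ 4)"
  obtains c z where "c \<noteq> 0" "c * c * k' = k * (z * z)"
proof -
  let ?g = "quadratic_form h 0 k" and ?h = "quadratic_form h 0 k'"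
  obtain P c where P: "similitude P c" and e: "\<And>v. ?g *v (P *v v) = P *v (?h *v v)"
    using assms by (auto simp: simconj_def)
  define S where "S = (\<lambda>u v. sympl u (?g *v v) - h * sympl u v)"
  have S: "S u v = u $ 1 * v $ 1 + k * (u $ 2 * v $ 2)" for u v
    by (simp add: S_def form_mult sympl_def algebra_simps)
  have S': "S (P *v u) (P *v v) = c * (u $ 1 * v $ 1 + k' * (u $ 2 * v $ 2))" for u v
  proof -
    have "S (P *v u) (P *v v) = c * (sympl u (?h *v v) - h * sympl u v)"
      using P by (simp add: S_def e similitude_def algebra_simps)
    thus ?thesis by (simp add: form_mult sympl_def algebra_simps)
  qed
  let ?u = "vector [1, 0, 0, 0] :: 'a ^ 4" and ?v = "vector [0, 1, 0, 0] :: 'a ^ 4"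
  define u v where "u = P *v ?u" and "v = P *v ?v"
  have "S u u = c" "S u v = 0" "S v v = c * k'"
    by (simp_all add: u_def v_def S')
  hence "c * (c * k') = S u u * S v v - S u v * S u v" by simp
  also have "\<dots> = k * ((u $ 1 * v $ 2 - u $ 2 * v $ 1) * (u $ 1 * v $ 2 - u $ 2 * v $ 1))"
    by (simp add: S algebra_simps)
  finally have "c * c * k' = k * ((u $ 1 * v $ 2 - u $ 2 * v $ 1) * (u $ 1 * v $ 2 - u $ 2 * v $ 1))"
    by (simp only: mult.assoc)
  moreover have "c \<noteq> 0" using P by (simp add: similitude_def)
  ultimately show ?thesis using that by blast
qed

text \<open>The factor \<open>z\<close> may vanish, so the comparison is made in both
  directions.\<close>

lemma nilpotent_invariant:
  assumes "simconj (quadratic_form h 0 k) (quadratic_form h 0 k' :: 'a::{field,finite} ^ 4 ^ 4)"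
    "(2::'a) \<noteq> 0" "k \<in> {0, 1, nonsquare}" "k' \<in> {0, 1, nonsquare}"
  shows "k = k'"
proof -
  obtain c z where 1: "c \<noteq> 0" "c * c * k' = k * (z * z)"
    using simconj_nilpotent[OF assms(1)] by blast
  obtain c' z' where 2: "c' \<noteq> 0" "c' * c' * k = k' * (z' * z')"
    using simconj_nilpotent[OF simconj_sym[OF assms(1)]] by blast
  have n: "nonsquare \<noteq> x * x" for x :: 'a
    using nonsquare[OF assms(2)] by (auto simp: is_square_def)
  have n': "c * c * nonsquare \<noteq> z * z" if "c \<noteq> 0" for c z :: 'a
  proof
    assume "c * c * nonsquare = z * z"
    hence "nonsquare = (z / c) * (z / c)" using that by (simp add: field_simps)
    thus False using n by blast
  qed
  show ?thesis
    using assms(3,4) 1 2 n[of 0] n'[of c z] n'[of c' z'] by auto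
qed

lemma cubic_relation_unique:
  assumes "cubic_relation g 0 1 r s" "cubic_relation g 0 1 r' s'"
    "\<And>r s. cubic_relation g 0 0 r s \<Longrightarrow> r = 0 \<and> s = 0"
  shows "r = r'" "s = s'"
  using assms(3)[of "r - r'" "s - s'"] cubic_relation_diff[OF assms(1,2)] 
  by (simp_all add: cubic_relation_def)

text \<open>Multiplier and minimal polynomial separate all forms, except \<open>Cyclic\<close> from
  \<open>Twisted\<close> and the \<open>Nilpotent\<close> forms with equal \<open>h\<close>; there
  the finer invariants decide.\<close>

lemma rep_inj:
  assumes conj: "simconj (rep x) (rep y)" and v: "valid x" "valid y"
    and two: "(2::'a::{field,finite}) \<noteq> 0"
  shows "x = (y :: 'a class_index)"
proof -
  have deg: "min_degree x = min_degree y"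
    using simconj_min_degree_le[OF conj v two] simconj_min_degree_le[OF simconj_sym[OF conj] v(2,1) two]
    by simp
  have mult: "multiplier x = multiplier y"
    using similitude_unique simconj_similitude conj similitude_rep v by blast
  consider "min_degree x = 4" | "min_degree x = 3" | "min_degree x = 2" | "min_degree x = 1"
    by (cases x) auto
  thus ?thesis
  proof cases
    case 1
    have q: "quartic_relation (cyclic_form l a b) a (- b) (l * a) (- (l * l))" if "l \<noteq> 0" for l a b :: 'a
      using that by (simp add: quartic_relation_def form_mult vec_eq_iff forall_4 field_simps)
    have q': "quartic_relation (root_form l s t) 0 (2 * l) 0 (- (l * l))" for l s t :: 'a
      by (simp add: quartic_relation_def form_mult vec_eq_iff forall_4 algebra_simps)
    \<comment> \<open>Comparing quartics leaves only the case where both have characteristic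
      polynomial (x^2 - l)^2.\<close>
    have ct: False if c: "simconj (root_form l 1 (twist l)) (cyclic_form l a b)" and l: "l \<noteq> 0" for l a b :: 'a
    proof -
      have "quartic_relation (cyclic_form l a b) 0 (2 * l) 0 (- (l * l))"
        using quartic_relation_simconj[OF c q'] .
      from cubic_relation_cyclic[OF quartic_relation_unique[OF q[OF l] this] l]
      have "a = 0" "- b - 2 * l = 0" by simp_all
      hence "a = 0" "b = - 2 * l" by (simp_all add: algebra_simps neg_eq_iff_add_eq_0 eq_neg_iff_add_eq_0)
      thus False using c cyclic_not_simconj_twisted[OF two twist[OF two l]] by simp
    qed
    show ?thesis
    proof (cases x)
      case x: (Cyclic l a b)
      show ?thesis
      proof (cases y)
        case y: (Cyclic l' a' b')
        have l: "l' = l" "l \<noteq> 0" using mult v by (auto simp: x y)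
        have "quartic_relation (cyclic_form l a' b') a (- b) (l * a) (- (l * l))"
          using quartic_relation_simconj[of "cyclic_form l a b" "cyclic_form l a' b'"] q[of l a b] conj l by (simp add: x y)
        from cubic_relation_cyclic[OF quartic_relation_unique[OF q[OF l(2), of a' b'] this] l(2)]
        have "a' = a" "b' = b" by simp_all
        thus ?thesis by (simp add: x y l)
      next
        case y: (Twisted l')
        thus ?thesis using ct[of l a b] simconj_sym[OF conj] mult v by (simp add: x)
      qed (use deg x in auto)
    next
      case x: (Twisted l)
      show ?thesis
      proof (cases y)
        case y: (Cyclic l' a' b')
        thus ?thesis using ct[of l a' b'] conj mult v by (simp add: x)
      qed (use deg mult x in auto)
    qed (use 1 in auto)
  next
    case 2
    then obtain m z m' z' where x: "x = Cubic m z" and y: "y = Cubic m' z'"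
      using deg by (cases x; cases y) auto
    have q: "cubic_relation (cubic_form m z) 1 (- (m + z)) (m * m + m * z) (- (m * m * m))" for m z :: 'a
      by (simp add: cubic_relation_def form_mult vec_eq_iff forall_4 algebra_simps)
    have "cubic_relation (cubic_form m' z') 1 (- (m + z)) (m * m + m * z) (- (m * m * m))"
      using cubic_relation_simconj[OF conj] q[of m z] by (simp add: x y)
    from cubic_relation_diff[OF q[of m' z'] this]
    have "- (m' + z') - - (m + z) = 0 \<and> m' * m' + m' * z' - (m * m + m * z) = 0 \<and>
      - (m' * m' * m') - - (m * m * m) = 0"
      by (rule cubic_relation_cubic) (use v in \<open>simp_all add: y\<close>)
    hence "m' + z' = m + z" "m' * m' * m' = m * m * m"
      by (metis right_minus_eq neg_equal_iff_equal)+
    moreover have "m' * m' = m * m" "m \<noteq> 0" using mult v by (simp_all add: x y)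
    ultimately show ?thesis by (simp add: x y)
  next
    case 3
    \<comment> \<open>\<open>r\<close> and \<open>s\<close> read off the minimal polynomial x^2 + r
      x + s; the zeros at constructors of other degree are placeholders.\<close>
    define r where "r = rec_class_index (\<lambda>_ _ _. 0) (\<lambda>_. 0) (\<lambda>_ _. 0) (\<lambda>_. 0) (\<lambda>h _. - 2 * h) (\<lambda>_. 0) (\<lambda>h _. - 2 * (h::'a))"
    define s where "s = rec_class_index (\<lambda>_ _ _. 0) (\<lambda>_. 0) (\<lambda>_ _. 0) (\<lambda>l. - l) (\<lambda>h d. h * h - d) (\<lambda>_. 0) (\<lambda>h _. h * (h::'a))"
    have q: "cubic_relation (rep x) 0 1 (r x) (s x)" if "min_degree x = 2" for x
      using that
      by (cases x) (simp_all add: r_def s_def cubic_relation_def form_mult vec_eq_iff forall_4 algebra_simps)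
    have "cubic_relation (rep y) 0 1 (r x) (s x)" "cubic_relation (rep y) 0 1 (r y) (s y)"
      using q[of x] q[of y] 3 deg cubic_relation_simconj[OF conj] by auto
    moreover have "cubic_relation (rep y) 0 0 r s \<Longrightarrow> r = 0 \<and> s = 0" for r s
      using not_linear_relation[of y r s] v two deg 3 by auto
    ultimately have rs: "r x = r y" "s x = s y"
      using cubic_relation_unique by blast+
    have nil: "k = k'" if "x = Nilpotent h k" "y = Nilpotent h k'" for h k k'
      using nilpotent_invariant[of h k k'] conj v two that by simp
    \<comment> \<open>The constant term equals the multiplier for \<open>Semisimple\<close> and
      \<open>Nilpotent\<close>, but is its negative for \<open>Root\<close>.\<close>
    have root: False if "w = Root l" "u \<in> {Semisimple h d, Nilpotent h d}" "r w = r u" "s w = s u"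
      "multiplier w = multiplier u" "valid w" for w u l h d
    proof -
      have "h = 0" using that(1-3) two by (auto simp: r_def)
      hence "l = - l" "l \<noteq> 0" using that by (auto simp: s_def)
      thus False using two by (metis add_eq_0_iff2 mult_2 mult_eq_0_iff)
    qed
    show ?thesis
    proof (cases x)
      case x: (Root l)
      show ?thesis
        using mult root[OF x _ rs mult v(1)] 3 deg by (cases y) (auto simp: x)
    next
      case x: (Semisimple h d)
      show ?thesis
      proof (cases y)
        case y: (Root l)
        show ?thesis using root[OF y _ rs[symmetric] mult[symmetric] v(2)] x by simp
      qed (use rs mult v two 3 deg in \<open>auto simp: x r_def s_def\<close>)
    next
      case x: (Nilpotent h d)
      show ?thesis
      proof (cases y)
        case y: (Root l)
        show ?thesis using root[OF y _ rs[symmetric] mult[symmetric] v(2)] x by simp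
      next
        case y: (Nilpotent h' d')
        have "- 2 * h = - 2 * h'" using rs(1) by (simp only: x y r_def class_index.rec)
        hence "h = h'" using two by (metis mult_left_cancel mult_minus_left neg_equal_iff_equal)
        thus ?thesis using nil[of h d d'] unfolding x y by blast
      qed (use rs mult v two 3 deg in \<open>auto simp: x r_def s_def\<close>)
    qed (use 3 in auto)
  next
    case 4
    then obtain h h' where x: "x = Scalar h" and y: "y = Scalar h'"
      using deg by (cases x; cases y) auto
    obtain P c where P: "similitude P c" "\<And>v. h *s (P *v v) = h' *s (P *v v)"
      using conj by (auto simp: simconj_def x y mat_vector_mult vector_scalar_commute)
    have "h *s (P *v (adj P *v axis 1 1)) = h' *s (P *v (adj P *v axis 1 1))"
      by (rule P(2))
    moreover have "c \<noteq> 0" using P(1) by (simp add: similitude_def)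
    ultimately show ?thesis
      by (simp add: x y similitude_adj[OF P(1)] vec_eq_iff axis_def split: if_splits)
  qed
qed

subsection \<open>The number of normal forms\<close>

text \<open>Beside q - 1, the constructors contribute in order the factors q^2, 1, q - 1, 1, q - 1,
  1 and 3.\<close>

lemma card_valid:
  assumes "(2::'a::{field,finite}) \<noteq> 0"
  shows "card {x :: 'a class_index. valid x} = (CARD('a)\<^sup>2 + 2 * CARD('a) + 4) * (CARD('a) - 1)"
proof -
  define U where "U = - {0::'a}"
  define n where "n = CARD('a) - 1"
  have q: "CARD('a) = n + 1" by (simp add: n_def)
  have U: "card U = n" by (simp add: U_def n_def Compl_eq_Diff_UNIV)
  have ns: "(nonsquare :: 'a) \<noteq> 0" "(nonsquare :: 'a) \<noteq> 1"
    using nonsquare[OF assms] by (auto simp: is_square_def) (metis mult_1)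
  let ?C1 = "(\<lambda>(l, a, b). Cyclic l a b) ` (U \<times> UNIV \<times> UNIV)"
  let ?C2 = "Twisted ` U"
  let ?C3 = "(\<lambda>(m, y). Cubic m y) ` (SIGMA m:U. - {2 * m})"
  let ?C4 = "Root ` U"
  let ?C5 = "(\<lambda>(h, d). Semisimple h d) ` (SIGMA h:UNIV. U - {h * h})"
  let ?C6 = "Scalar ` U"
  let ?C7 = "(\<lambda>(h, k). Nilpotent h k) ` (U \<times> {0, 1, nonsquare :: 'a})"
  have "valid x \<longleftrightarrow> x \<in> ?C1 \<union> (?C2 \<union> (?C3 \<union> (?C4 \<union> (?C5 \<union> (?C6 \<union> ?C7)))))" for x :: "'a class_index"
    by (cases x) (auto simp: U_def image_iff)
  hence e: "{x. valid x} = ?C1 \<union> (?C2 \<union> (?C3 \<union> (?C4 \<union> (?C5 \<union> (?C6 \<union> ?C7)))))"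
    by blast
  have "card {x :: 'a class_index. valid x} = card ?C1 + (card ?C2 + (card ?C3 + (card ?C4 + (card ?C5 + (card ?C6 + card ?C7)))))"
    unfolding e by (subst card_Un_disjoint; (auto; fail)?)+
  moreover have "card ?C1 = n * (CARD('a) * CARD('a))"
    by (subst card_image) (auto simp: inj_on_def U)
  moreover have "card ?C2 = n"
    by (subst card_image) (auto simp: inj_on_def U)
  moreover have "card ?C3 = n * n"
    by (subst card_image) (auto simp: inj_on_def U n_def Compl_eq_Diff_UNIV)
  moreover have "card ?C4 = n"
    by (subst card_image) (auto simp: inj_on_def U)
  \<comment> \<open>\<open>h = 0\<close> leaves \<open>n\<close> values of \<open>d\<close>, every
    other \<open>h\<close> leaves \<open>n - 1\<close>.\<close>
  moreover have "card ?C5 = n * n"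
  proof -
    have "card ?C5 = (\<Sum>h\<in>UNIV. card (U - {h * h :: 'a}))"
      by (subst card_image) (auto simp: inj_on_def)
    also have "\<dots> = (\<Sum>h\<in>insert 0 U. card (U - {h * h :: 'a}))"
      by (rule sum.cong) (auto simp: U_def)
    also have "\<dots> = n + (\<Sum>h\<in>U. card (U - {h * h :: 'a}))"
      using U by (subst sum.insert) (auto simp: U_def card_Diff_singleton_if)
    also have "(\<Sum>h\<in>U. card (U - {h * h :: 'a})) = (\<Sum>h\<in>U. n - 1)"
      by (rule sum.cong) (auto simp: U_def U[unfolded U_def])
    also have "n + (\<Sum>h\<in>U. n - 1) = n * n"
      by (cases n) (auto simp: U)
    finally show ?thesis .
  qed
  moreover have "card ?C6 = n"
    by (subst card_image) (auto simp: inj_on_def U)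
  moreover have "card ?C7 = n * 3"
    using ns by (subst card_image) (auto simp: inj_on_def U card_insert_if)
  ultimately have "card {x :: 'a class_index. valid x} =
      n * (CARD('a) * CARD('a)) + (n + (n * n + (n + (n * n + (n + n * 3)))))"
    by presburger
  thus ?thesis
    unfolding q by (simp add: power2_eq_square algebra_simps)
qed

lemma card_conjugacy_classes_GSp4:
  assumes two: "(2::'a::{field,finite}) \<noteq> 0"
    and complete: "\<And>g l. similitude (g :: 'a ^ 4 ^ 4) l \<Longrightarrow> \<exists>x. valid x \<and> simconj g (rep x)"
  shows "card (conjugacy_classes (GSp4 :: ('a ^ 4 ^ 4) monoid)) = (CARD('a)\<^sup>2 + 2 * CARD('a) + 4) * (CARD('a) - 1)"
proof -
  define C where "C = (\<lambda>h :: 'a ^ 4 ^ 4. {g. simconj g h})"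
  have C: "C g = C h" if "simconj g h" for g h
    using that unfolding C_def by (auto intro: simconj_trans simconj_sym)
  have "C ` carrier GSp4 = (\<lambda>x. C (rep x)) ` {x. valid x}"
  proof
    show "C ` carrier GSp4 \<subseteq> (\<lambda>x. C (rep x)) ` {x. valid x}"
      using complete C by (fastforce simp: mem_GSp4_iff_similitude)
    show "(\<lambda>x. C (rep x)) ` {x. valid x} \<subseteq> C ` carrier GSp4"
    proof (rule image_subsetI)
      fix x :: "'a class_index" assume "x \<in> {x. valid x}"
      hence "rep x \<in> carrier GSp4" using similitude_rep by (auto simp: mem_GSp4_iff_similitude)
      thus "C (rep x) \<in> C ` carrier GSp4" by (rule imageI)
    qed
  qed
  moreover have "inj_on (\<lambda>x. C (rep x)) {x. valid x}"
  proof (rule inj_onI)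
    fix x y :: "'a class_index"
    assume "x \<in> {x. valid x}" "y \<in> {x. valid x}" "C (rep x) = C (rep y)"
    thus "x = y" using simconj_refl[of "rep x"] rep_inj[OF _ _ _ two] by (auto simp: C_def)
  qed
  ultimately show ?thesis
    using card_valid[OF two] by (simp add: conjugacy_classes_GSp4 C_def card_image)
qed

section \<open>Every similitude is conjugate to a normal form\<close>

subsection \<open>Symplectic complements\<close>

lemma ex_not_in_plane:
  fixes e f :: "'a::{field,finite} ^ 4"
  obtains v where "\<And>x y. v \<noteq> x *s e + y *s f"
proof -
  have "range (\<lambda>(x, y). x *s e + y *s f) \<noteq> UNIV"
  proof
    assume eq: "range (\<lambda>(x, y). x *s e + y *s f) = UNIV"
    have "card (range (\<lambda>(x, y). x *s e + y *s f)) \<le> card (UNIV :: ('a \<times> 'a) set)"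
      by (rule card_image_le) simp
    also have "\<dots> = CARD('a) * CARD('a)" by simp
    finally have "CARD('a ^ 4) \<le> CARD('a) * CARD('a)" by (simp add: eq)
    hence "CARD('a) * CARD('a) * (CARD('a) * CARD('a)) \<le> CARD('a) * CARD('a) * 1"
      by (simp add: power4_eq_xxxx)
    moreover have "CARD('a) > 1"
      using card_mono[of UNIV "{0, 1 :: 'a}"] by simp
    ultimately show False by (simp only: mult_le_cancel1) (metis less_1_mult not_less zero_less_one_class.zero_less_one less_trans mult_pos_pos)
  qed
  then obtain v where "v \<notin> range (\<lambda>(x, y). x *s e + y *s f)" by blast
  thus ?thesis using that[of v] by (auto simp: image_iff)
qed

definition perp :: "'a::field ^ 4 \<Rightarrow> 'a ^ 4 \<Rightarrow> ('a ^ 4) set" where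
  "perp e f = {v. sympl v e = 0 \<and> sympl v f = 0}"

lemma perp_proj:
  fixes e f :: "'a::field ^ 4"
  assumes "sympl e f \<noteq> 0"
  shows "v - (sympl v f / sympl e f) *s e + (sympl v e / sympl e f) *s f \<in> perp e f"
  using assms sympl_swap[of f e] by (simp add: perp_def sympl_linear)

lemma perp_proj_sympl:
  assumes "u \<in> perp e f"
  shows "sympl u (v - x *s e + y *s f) = sympl u v"
    "sympl (v - x *s e + y *s f) u = sympl v u"
  using assms sympl_swap[of u e] sympl_swap[of u f] by (auto simp: perp_def sympl_linear)

text \<open>Project a vector outside the plane to get \<open>u\<close>, then project a partner of
  \<open>u\<close>, which leaves their pairing unchanged.\<close>

lemma perp_symplectic_pair:
  fixes e f :: "'a::{field,finite} ^ 4"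
  assumes "sympl e f \<noteq> 0"
  obtains u w where "u \<in> perp e f" "w \<in> perp e f" "sympl u w = sympl e f"
proof -
  obtain v where v: "\<And>x y. v \<noteq> x *s e + y *s f" using ex_not_in_plane[of e f] by blast
  define u where "u = v - (sympl v f / sympl e f) *s e + (sympl v e / sympl e f) *s f"
  have u: "u \<in> perp e f" unfolding u_def by (rule perp_proj[OF assms])
  have "u \<noteq> 0"
  proof
    assume "u = 0"
    hence "v = (sympl v f / sympl e f) *s e + (- (sympl v e / sympl e f)) *s f"
      by (simp add: u_def vec_eq_iff algebra_simps eq_neg_iff_add_eq_0)
    thus False using v by blast
  qed
  then obtain w' where w': "sympl w' u = - sympl e f" by (rule sympl_partner)
  define w where "w = w' - (sympl w' f / sympl e f) *s e + (sympl w' e / sympl e f) *s f"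
  have "w \<in> perp e f" unfolding w_def by (rule perp_proj[OF assms])
  moreover have "sympl u w = sympl e f"
    using w' sympl_swap[of u w'] by (simp add: w_def perp_proj_sympl[OF u])
  ultimately show ?thesis using that u by blast
qed

subsection \<open>Similitudes with a quadratic equation\<close>

text \<open>The case of scalar trace 2 h: then N = g - h is skew-adjoint and N^2 = h^2 - l.\<close>

locale skew_square =
  fixes N :: "'a::{field,finite} ^ 4 ^ 4" and d :: 'a
  assumes skew: "sympl (N *v u) v = - sympl u (N *v v)"
    and square: "N *v (N *v v) = d *s v"
    and two: "(2::'a) \<noteq> 0"
begin

lemma form_sym: "sympl u (N *v v) = sympl v (N *v u)"
  by (metis skew sympl_swap)

lemma polarize:
  assumes "sympl (u + v) (N *v (u + v)) = 0" "sympl u (N *v u) = 0" "sympl v (N *v v) = 0"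
  shows "sympl u (N *v v) = 0"
  using assms form_sym[of u v] two by (simp add: matrix_vector_right_distrib sympl_linear flip: mult_2)

lemma ex_anisotropic:
  assumes "N *v v \<noteq> 0"
  obtains e where "sympl e (N *v e) \<noteq> 0"
  using polarize sympl_nondegenerate assms by blast

lemma perp_closed:
  assumes "u \<in> perp e (N *v e)"
  shows "N *v u \<in> perp e (N *v e)"
  using assms by (simp add: perp_def skew square sympl_linear)

text \<open>Polarizing kills the pairing of \<open>N *v u\<close> with the complement, and
  \<open>N *v u\<close> lies in that complement, so it pairs with any vector as with its
  projection.\<close>

lemma perp_isotropic:
  assumes e: "sympl e (N *v e) \<noteq> 0"
    and iso: "\<And>u. u \<in> perp e (N *v e) \<Longrightarrow> sympl u (N *v u) = 0" and u: "u \<in> perp e (N *v e)"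
  shows "N *v u = 0"
proof (rule sympl_nondegenerate)
  fix v
  let ?p = "v - (sympl v (N *v e) / sympl e (N *v e)) *s e + (sympl v e / sympl e (N *v e)) *s (N *v e)"
  have p: "?p \<in> perp e (N *v e)" by (rule perp_proj[OF e])
  moreover from p u have "?p + u \<in> perp e (N *v e)" by (simp add: perp_def sympl_linear)
  ultimately have "sympl ?p (N *v u) = 0" using iso u polarize by blast
  thus "sympl v (N *v u) = 0"
    by (simp only: perp_proj_sympl[OF perp_closed[OF u]])
qed

text \<open>On \<open>e\<close>, \<open>N *v e\<close> the form is diagonal with nonzero entries
  \<open>?c\<close> and \<open>- d * ?c\<close>, hence universal.\<close>

lemma ex_unit:
  assumes "d \<noteq> 0" "sympl e (N *v e) \<noteq> 0"
  obtains x y where "sympl (x *s e + y *s (N *v e)) (N *v (x *s e + y *s (N *v e))) = 1"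
proof -
  let ?c = "sympl e (N *v e)"
  obtain x y where xy: "?c * (x * x) + (- d * ?c) * (y * y) = 1"
    using diagonal_form_universal[of ?c "- d * ?c" 1] assms by auto
  have "sympl (N *v e) e = - ?c" by (rule sympl_swap)
  hence "sympl (x *s e + y *s (N *v e)) (N *v (x *s e + y *s (N *v e))) = ?c * (x * x) + (- d * ?c) * (y * y)"
    by (simp add: matrix_vector_right_distrib vector_scalar_commute square sympl_linear algebra_simps)
  thus ?thesis using that xy by simp
qed

lemma perp_comb:
  "u \<in> perp e f \<Longrightarrow> w \<in> perp e f \<Longrightarrow> x *s u + y *s w \<in> perp e f"
  by (simp add: perp_def sympl_linear)

text \<open>Diagonalize the symmetric form B(u, N v). For nonzero \<open>d\<close> two orthogonal
  vectors of value 1 exist; for \<open>d = 0\<close> only the ratio of the diagonal values modulo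
  squares matters, as the basis factor \<open>c\<close> absorbs the first one.\<close>

lemma ex_normal_form:
  assumes g: "\<And>v. g *v v = h *s v + N *v v" and l: "h * h \<noteq> d"
  shows "\<exists>x. valid x \<and> simconj g (rep x)"
proof (cases "\<forall>v. N *v v = 0")
  case True
  have "d *s axis 1 1 = (0 :: 'a ^ 4)" using square[of "axis 1 1"] True by simp
  hence "d = 0" by (simp add: vec_eq_iff axis_def split: if_splits)
  moreover have "g = mat h" by (rule matrix_ext) (simp add: g True mat_vector_mult)
  ultimately have "valid (Scalar h)" "simconj g (rep (Scalar h))"
    using l simconj_refl by auto
  thus ?thesis by blast
next
  case False
  then obtain e0 where e0: "sympl e0 (N *v e0) \<noteq> 0" using ex_anisotropic by blast
  show ?thesis
  proof (cases "d = 0")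
    case d: False
    obtain e where e: "sympl e (N *v e) = 1" using ex_unit[OF d e0] by blast
    hence e': "sympl e (N *v e) \<noteq> 0" by simp
    obtain u w where uw: "u \<in> perp e (N *v e)" "sympl u w = 1"
      using perp_symplectic_pair[OF e'] e by metis
    have "N *v u \<noteq> 0"
      using square[of u] uw(2) d by auto
    then obtain f0 where f0: "f0 \<in> perp e (N *v e)" "sympl f0 (N *v f0) \<noteq> 0"
      using perp_isotropic[OF e' _ uw(1)] by blast
    then obtain x y where xy: "sympl (x *s f0 + y *s (N *v f0)) (N *v (x *s f0 + y *s (N *v f0))) = 1"
      using ex_unit[OF d] by blast
    define f where "f = x *s f0 + y *s (N *v f0)"
    have f: "f \<in> perp e (N *v e)" "sympl f (N *v f) = 1"
      using perp_comb[OF f0(1) perp_closed[OF f0(1)]] xy by (simp_all add: f_def)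
    have f': "sympl f e = 0" "sympl f (N *v e) = 0" "sympl e f = 0"
      using f(1) sympl_swap[of e f] by (simp_all add: perp_def)
    have "simconj g (quadratic_form h d 1)"
    proof (rule symplectic_basis_simconj[where ?v1.0 = e and ?v2.0 = f and ?v3.0 = "N *v f" and ?v4.0 = "N *v e" and c = 1])
      show "sympl e (N *v f) = 0" using f'(2) form_sym by metis
      show "sympl (N *v f) (N *v e) = 0" using f'(1) by (simp add: skew square sympl_linear)
    qed (use e f f' in \<open>simp_all add: g square quadratic_form_def\<close>)
    hence "valid (Semisimple h d)" "simconj g (rep (Semisimple h d))"
      using d l by auto
    thus ?thesis by blast
  next
    case d: True
    have h: "h \<noteq> 0" using l d by auto
    define c where "c = sympl e0 (N *v e0)"
    show ?thesis
    proof (cases "\<exists>f\<in>perp e0 (N *v e0). sympl f (N *v f) \<noteq> 0")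
      case True
      then obtain f0 where f0: "f0 \<in> perp e0 (N *v e0)" "sympl f0 (N *v f0) \<noteq> 0" by blast
      obtain k z where k: "k \<in> {1, nonsquare}" "k \<noteq> 0" "z * z * sympl f0 (N *v f0) = k * c"
      proof (cases "is_square (sympl f0 (N *v f0) / c)")
        case True
        then obtain y where "sympl f0 (N *v f0) / c = y * y" by (auto simp: is_square_def)
        hence "sympl f0 (N *v f0) = y * y * c" "y \<noteq> 0" using e0 f0 by (auto simp: c_def field_simps)
        thus ?thesis using that[of 1 "1 / y"] by simp
      next
        case False
        hence "is_square (sympl f0 (N *v f0) / c * nonsquare)"
          by (rule nonsquare_mult[OF _ nonsquare[OF two]])
        then obtain y where y: "sympl f0 (N *v f0) / c * nonsquare = y * y"
          unfolding is_square_def by blast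
        have n: "(nonsquare :: 'a) \<noteq> 0" using nonsquare[OF two] by (auto simp: is_square_def)
        hence "y * y \<noteq> 0" using y e0 f0 by (auto simp: c_def)
        moreover have "sympl f0 (N *v f0) = y * y * c / nonsquare" using y n e0 by (simp add: c_def field_simps)
        ultimately show ?thesis using that[of nonsquare "nonsquare / y"] n by (simp add: field_simps)
      qed
      define f where "f = z *s f0"
      have f: "f \<in> perp e0 (N *v e0)" "sympl f (N *v f) = k * c"
        using f0(1) k(3) by (simp_all add: f_def perp_def sympl_linear vector_scalar_commute mult.assoc)
      have f': "sympl f e0 = 0" "sympl f (N *v e0) = 0" "sympl e0 f = 0"
        using f(1) sympl_swap[of e0 f] by (simp_all add: perp_def)
      have "simconj g (quadratic_form h 0 k)"
      proof (rule symplectic_basis_simconj[where ?v1.0 = e0 and ?v2.0 = f and ?v3.0 = "(1 / k) *s (N *v f)" and ?v4.0 = "N *v e0" and c = c])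
        have "sympl e0 (N *v f) = 0" using f'(2) form_sym by metis
        thus "sympl e0 ((1 / k) *s (N *v f)) = 0" by (simp add: sympl_linear)
        show "sympl ((1 / k) *s (N *v f)) (N *v e0) = 0" using f'(1) by (simp add: skew square sympl_linear)
      qed (use e0 f f' k(2) in \<open>simp_all add: c_def g square quadratic_form_def sympl_linear d vector_scalar_commute vector_smult_assoc vector_add_ldistrib mult.commute\<close>)
      hence "valid (Nilpotent h k)" "simconj g (rep (Nilpotent h k))"
        using k h by auto
      thus ?thesis by blast
    next
      case False
      obtain u w where uw: "u \<in> perp e0 (N *v e0)" "w \<in> perp e0 (N *v e0)" "sympl u w = c"
        using perp_symplectic_pair[OF e0] unfolding c_def by metis
      have N: "N *v u = 0" "N *v w = 0"
        using False perp_isotropic[OF e0] uw by blast+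
      have "simconj g (quadratic_form h 0 0)"
        by (rule symplectic_basis_simconj[where ?v1.0 = e0 and ?v2.0 = u and ?v3.0 = w and ?v4.0 = "N *v e0" and c = c])
          (use e0 uw sympl_swap[of e0 u] sympl_swap[of e0 w] in \<open>simp_all add: c_def g square quadratic_form_def d N perp_def\<close>)
      hence "valid (Nilpotent h 0)" "simconj g (rep (Nilpotent h 0))"
        using h by auto
      thus ?thesis by blast
    qed
  qed
qed

end

subsection \<open>The algebra generated by a similitude and its adjoint\<close>

locale similitude_trace =
  fixes g T :: "'a::{field,finite} ^ 4 ^ 4" and l a b :: 'a
  assumes sim: "similitude g l" and two: "(2::'a) \<noteq> 0" and T_def: "T = g + adj g"
    and T_square: "T *v (T *v v) = a *s (T *v v) - b *s v"
begin

lemma l_nonzero: "l \<noteq> 0"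
  using sim by (simp add: similitude_def)

lemma four_nonzero: "(4::'a) \<noteq> 0"
proof -
  have "(2::'a) * 2 \<noteq> 0" using two by (simp only: mult_eq_0_iff) simp
  thus ?thesis by simp
qed

lemma T_mult: "T *v v = g *v v + adj g *v v"
  by (simp add: T_def matrix_vector_mult_add_rdistrib)

lemma T_selfadj: "sympl (T *v u) v = sympl u (T *v v)"
  by (simp add: T_def sympl_adj adj_add add.commute)

lemma g_square: "g *v (g *v v) = T *v (g *v v) - l *s v"
  by (simp add: T_mult similitude_adj[OF sim])

lemma g_T: "g *v (T *v v) = T *v (g *v v)"
  by (simp add: T_mult matrix_vector_right_distrib similitude_adj[OF sim])

lemma g_skew: "sympl (g *v u) v = sympl u (T *v v) - sympl u (g *v v)"
  by (simp add: sympl_adj T_mult sympl_linear)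

lemma T_alt: "sympl v (T *v v) = 0"
  using T_selfadj[of v v] sympl_swap[of "T *v v" v] two
  by (metis add_eq_0_iff2 mult_2 mult_eq_0_iff)

text \<open>Expresses everything through \<open>v\<close>, \<open>T *v v\<close>,
  \<open>g *v v\<close>, \<open>T *v (g *v v)\<close> and moves operators to the right argument of
  the form.\<close>

lemmas normalize = matrix_vector_right_distrib matrix_vector_mult_diff_distrib vector_scalar_commute
  sympl_linear T_square T_selfadj g_square g_T g_skew T_alt

definition s where "s v = sympl v (g *v v)"
definition t where "t v = sympl v (T *v (g *v v))"
definition H where "H v = t v * t v - a * (s v * t v) + b * (s v * s v)"

text \<open>The pair \<open>(s v, t v)\<close> is an element of \<open>K = k[T]\<close> that gets multiplied by \<open>(x + y T)\<^sup>2\<close>, and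
  \<^const>\<open>H\<close> is its norm.\<close>

lemma st_T:
  "s (x *s v + y *s (T *v v)) = x * x * s v + 2 * (x * y) * t v + y * y * (a * t v - b * s v)"
  "t (x *s v + y *s (T *v v)) = x * x * t v + 2 * (x * y) * (a * t v - b * s v)
    + y * y * (a * (a * t v - b * s v) - b * t v)"
  by (simp_all add: s_def t_def normalize algebra_simps)

text \<open>The factor is the squared norm of x + y T.\<close>

lemma H_T: "H (x *s v + y *s (T *v v)) = (x * x + a * (x * y) + b * (y * y)) * (x * x + a * (x * y) + b * (y * y)) * H v"
  unfolding H_def st_T by (simp add: algebra_simps)

section \<open>Vectors with prescribed ratio of s and t\<close>

lemma simconj_cyclic:
  assumes "s v = 0" "t v \<noteq> 0"
  shows "simconj g (cyclic_form l a (b + 2 * l))"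
proof -
  have s: "sympl v (g *v v) = 0" using assms(1) by (simp add: s_def)
  \<comment> \<open>These are g^2 v and (g^3 v - a g^2 v) / l, reduced by the quadratic equation of
    T.\<close>
  let ?v4 = "T *v (g *v v) - l *s v"
  let ?v3 = "a *s v - T *v v - ((b + l) / l) *s (g *v v)"
  show ?thesis
  proof (rule symplectic_basis_simconj[where ?v1.0 = v and ?v2.0 = "g *v v" and ?v3.0 = ?v3 and ?v4.0 = ?v4 and c = "t v"])
    show "t v \<noteq> 0" by fact
  qed (use l_nonzero in \<open>simp_all add: t_def normalize s cyclic_form_def vec_eq_iff field_simps\<close>)
qed

lemma ex_cyclic:
  assumes "s v = 0" "t v \<noteq> 0"
  shows "\<exists>x. valid x \<and> simconj g (rep x)"
  using simconj_cyclic[OF assms] l_nonzero by (intro exI[of _ "Cyclic l a (b + 2 * l)"]) simp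

text \<open>\<open>s\<close> at (x + y T) v is a quadratic form in x, y with discriminant
  \<open>H v\<close>, so it has a zero when \<open>H v\<close> is a square. The sign of the root
  \<open>w\<close> is chosen so that x + y T has nonzero norm.\<close>

lemma ex_cyclic_square:
  assumes "is_square (H v)" "H v \<noteq> 0"
  shows "\<exists>x. valid x \<and> simconj g (rep x)"
proof (cases "s v = 0")
  case True
  thus ?thesis using ex_cyclic assms(2) by (simp add: H_def)
next
  case False
  obtain r where r: "H v = r * r" using assms(1) by (auto simp: is_square_def)
  hence "r \<noteq> 0" using assms(2) by auto
  obtain w where w: "H v = w * w" "w \<noteq> 0" "2 * w + a * s v - 2 * t v \<noteq> 0"
  proof (cases "2 * r + a * s v - 2 * t v = 0")
    case True
    have "2 * (- r) + a * s v - 2 * t v = (2 * r + a * s v - 2 * t v) - 2 * 2 * r"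
      by (simp add: algebra_simps)
    also have "\<dots> \<noteq> 0" using True four_nonzero \<open>r \<noteq> 0\<close> by simp
    finally show ?thesis using that[of "- r"] r \<open>r \<noteq> 0\<close> by simp
  next
    case False
    thus ?thesis using that r \<open>r \<noteq> 0\<close> by blast
  qed
  define u where "u = (w - t v) *s v + s v *s (T *v v)"
  have "s u = s v * (w * w - H v)"
    unfolding u_def st_T by (simp add: H_def algebra_simps)
  hence su: "s u = 0" using w by simp
  let ?n = "(w - t v) * (w - t v) + a * ((w - t v) * s v) + b * (s v * s v)"
  have "?n = H v + w * w + w * (a * s v - 2 * t v)"
    by (simp add: H_def algebra_simps)
  also have "\<dots> = w * (2 * w + a * s v - 2 * t v)"
    by (simp add: w(1) algebra_simps)
  finally have "?n \<noteq> 0" using w by simp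
  hence "H u \<noteq> 0" unfolding u_def H_T using assms(2) by simp
  hence "t u \<noteq> 0" using su by (simp add: H_def)
  thus ?thesis using ex_cyclic su by blast
qed

lemma simconj_twisted:
  assumes ab: "a = 0" "b = - 4 * l" and s: "s v \<noteq> 0" and t: "t v = 2 * r * s v" and r: "r * r \<noteq> l"
  shows "simconj g (root_form l 1 r)"
proof -
  define c where "c = s v"
  have sv: "sympl v (g *v v) = c" "sympl v (T *v (g *v v)) = 2 * r * c"
    using t by (simp_all add: c_def s_def t_def)
  \<comment> \<open>With C = T / 2, so C^2 = l, and M = g - C, these are M v, C M v and C v.\<close>
  define m where "m = g *v v - (1 / 2) *s (T *v v)"
  define cm where "cm = (1 / 2) *s (T *v (g *v v)) - l *s v"
  define cv where "cv = (1 / 2) *s (T *v v)"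
  have g: "g *v v = cv + m" "g *v cv = l *s v + cm" "g *v m = cm" "g *v cm = l *s m"
    using two four_nonzero by (simp_all add: m_def cm_def cv_def normalize ab vec_eq_iff field_simps)
  have vv: "sympl v cv = 0" "sympl v m = c" "sympl v cm = r * c" "sympl cv m = r * c" "sympl cv cm = l * c"
    "sympl m cm = 0"
    using two four_nonzero by (simp_all add: m_def cm_def cv_def normalize ab sv field_simps)
  \<comment> \<open>\<open>v4\<close>, \<open>v3\<close> is the basis dual to \<open>v\<close>,
    \<open>cv\<close> up to \<open>c\<close>; \<open>k\<close> inverts the determinant of the
    pairings of \<open>v\<close>, \<open>cv\<close> with \<open>m\<close>,
    \<open>cm\<close>.\<close>
  define k where "k = 1 / (l - r * r)"
  have k: "k * (l - r * r) = 1" using r by (simp add: k_def)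
  define v3 where "v3 = k *s (cm - r *s m)"
  define v4 where "v4 = k *s (l *s m - r *s cm)"
  have comb: "m = v4 + r *s v3" "cm = r *s v4 + l *s v3"
  proof -
    have "m $ i = k * (l * m $ i - r * cm $ i) + r * (k * (cm $ i - r * m $ i))"
      "cm $ i = r * (k * (l * m $ i - r * cm $ i)) + l * (k * (cm $ i - r * m $ i))" for i
    proof -
      have "k * (l * x - r * y) + r * (k * (y - r * x)) = k * (l - r * r) * x"
        "r * (k * (l * x - r * y)) + l * (k * (y - r * x)) = k * (l - r * r) * y" for x y
        by (simp_all add: algebra_simps)
      thus "m $ i = k * (l * m $ i - r * cm $ i) + r * (k * (cm $ i - r * m $ i))"
        "cm $ i = r * (k * (l * m $ i - r * cm $ i)) + l * (k * (cm $ i - r * m $ i))"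
        by (simp_all only: k mult_1)
    qed
    thus "m = v4 + r *s v3" "cm = r *s v4 + l *s v3"
      unfolding v3_def v4_def vec_eq_iff vector_add_component vector_minus_component vector_smult_component
      by blast+
  qed
  have g34: "g *v v3 = v4" "g *v v4 = l *s v3"
    by (simp_all add: v3_def v4_def g matrix_vector_mult_diff_distrib vector_scalar_commute vec_eq_iff algebra_simps)
  have v34: "sympl v v3 = 0" "sympl v v4 = c" "sympl cv v3 = c" "sympl cv v4 = 0" "sympl v3 v4 = 0"
  proof -
    have "k * (l * c - r * (r * c)) = k * (l - r * r) * c" by (simp add: algebra_simps)
    hence "k * (l * c - r * (r * c)) = c" by (simp only: k mult_1)
    thus "sympl v v3 = 0" "sympl v v4 = c" "sympl cv v3 = c" "sympl cv v4 = 0" "sympl v3 v4 = 0"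
      using sympl_swap[of cm m] by (simp_all add: v3_def v4_def sympl_linear vv)
  qed
  have g12: "g *v v = cv + r *s v3 + v4" "g *v cv = l *s v + l *s v3 + r *s v4"
  proof -
    have "g *v v = cv + (v4 + r *s v3)" "g *v cv = l *s v + (r *s v4 + l *s v3)"
      by (simp_all only: g comb[symmetric])
    thus "g *v v = cv + r *s v3 + v4" "g *v cv = l *s v + l *s v3 + r *s v4"
      by (simp_all only: add_ac)
  qed
  have "c \<noteq> 0" using s by (simp add: c_def)
  thus ?thesis
    by (rule symplectic_basis_simconj[of c v v4 cv v3]) (simp_all add: v34 vv g12 g34 root_form_def)
qed

text \<open>The condition t = 2 r s on (x + y T) v is the equation A x^2 + 2 B x y + 4 l A y^2 = 0.
  Its discriminant is 4 (r^2 - l) H(v), a square as a product of two nonsquares.\<close>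

lemma ex_twisted:
  assumes ab: "a = 0" "b = - 4 * l" and ns: "\<not> is_square (H v)"
  shows "\<exists>x. valid x \<and> simconj g (rep x)"
proof -
  define r where "r = twist l"
  have r: "\<not> is_square (r * r - l)"
    unfolding r_def by (rule twist[OF two l_nonzero])
  have rl: "r * r \<noteq> l" using r by (auto simp: is_square_def)
  have H0: "H v \<noteq> 0" using ns by (auto simp: is_square_def)
  have "\<exists>u. s u \<noteq> 0 \<and> t u = 2 * r * s u"
  proof (cases "t v = 2 * r * s v")
    case True
    moreover from True have "s v \<noteq> 0" using H0 by (auto simp: H_def)
    ultimately show ?thesis by blast
  next
    case False
    define A where "A = t v - 2 * r * s v"
    define B where "B = 4 * l * s v - 2 * r * t v"
    have "is_square ((r * r - l) * H v)" using nonsquare_mult r ns by blast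
    then obtain z where z: "(r * r - l) * H v = z * z" by (auto simp: is_square_def)
    define w where "w = 2 * z"
    have "z \<noteq> 0" using z rl H0 by auto
    hence w: "w \<noteq> 0" using two by (simp add: w_def)
    have disc: "B * B - 4 * l * (A * A) = w * w"
    proof -
      have Hv: "H v = t v * t v - 4 * l * (s v * s v)"
        unfolding H_def by (simp add: ab)
      have "B * B - 4 * l * (A * A) = 4 * ((r * r - l) * H v)"
        unfolding A_def B_def Hv by (simp add: algebra_simps)
      thus ?thesis by (simp add: z w_def)
    qed
    \<comment> \<open>The sign of the root keeps the norm of x + y T nonzero.\<close>
    obtain w' where w': "w' * w' = w * w" "w' \<noteq> 0" "w' \<noteq> B"
      using w two by (metis add_eq_0_iff2 minus_mult_minus mult_2 mult_eq_0_iff neg_equal_0_iff_equal)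
    define u where "u = (w' - B) *s v + A *s (T *v v)"
    have "t u - 2 * r * s u = A * (w' * w' - (B * B - 4 * l * (A * A)))"
      unfolding u_def st_T by (simp add: A_def B_def ab algebra_simps)
    hence tu: "t u = 2 * r * s u" by (simp add: disc w')
    let ?n = "(w' - B) * (w' - B) + a * ((w' - B) * A) + b * (A * A)"
    have "?n = w' * w' - 2 * B * w' + (B * B - 4 * l * (A * A))"
      by (simp add: ab algebra_simps)
    also have "\<dots> = 2 * w' * (w' - B)"
      by (simp only: disc flip: w'(1)) (simp add: algebra_simps)
    finally have "?n \<noteq> 0" using w' two by simp
    hence "H u \<noteq> 0" unfolding u_def H_T using H0 by simp
    hence "s u \<noteq> 0" using tu by (auto simp: H_def)
    thus ?thesis using tu by blast
  qed
  then obtain u where "s u \<noteq> 0" "t u = 2 * r * s u" by blast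
  hence "simconj g (root_form l 1 r)" using simconj_twisted[OF ab _ _ rl] by blast
  thus ?thesis using l_nonzero by (intro exI[of _ "Twisted l"]) (simp add: r_def)
qed

end

subsection \<open>Irreducible trace polynomial\<close>

context similitude_trace
begin

text \<open>The polar form of \<open>s\<close> is B(x, (2 g - T) y), so the hypotheses make the
  K-lines of \<open>v\<close> and \<open>u\<close> orthogonal.\<close>

lemma st_add:
  assumes "sympl v (2 *s (g *v u) - T *v u) = 0" "sympl (T *v v) (2 *s (g *v u) - T *v u) = 0"
  defines "p \<equiv> \<lambda>x y. x *s v + y *s (T *v v)" and "q \<equiv> \<lambda>z w. z *s u + w *s (T *v u)"
  shows "s (p x y + q z w) = s (p x y) + s (q z w)" "t (p x y + q z w) = t (p x y) + t (q z w)"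
proof -
  have 1: "2 * sympl v (g *v u) = sympl v (T *v u)"
    "2 * sympl v (T *v (g *v u)) = a * sympl v (T *v u) - b * sympl v u"
    using assms(1,2) by (simp_all add: normalize)
  have "sympl u (g *v v) = sympl v (g *v u) - sympl v (T *v u)"
     "sympl u (T *v (g *v v)) = sympl v (T *v (g *v u)) - (a * sympl v (T *v u) - b * sympl v u)"
    "sympl u (T *v v) = - sympl v (T *v u)" "sympl u v = - sympl v u"
    using sympl_swap[of u "g *v v"] sympl_swap[of u "T *v (g *v v)"] sympl_swap[of u "T *v v"] sympl_swap[of u v]
    by (simp_all add: normalize)
  note n = this
  have s2: "s (p x y + q z w) - s (p x y) - s (q z w) = 
     (x * z) * (2 * sympl v (g *v u) - sympl v (T *v u))
     + (x * w + y * z) * (2 * sympl v (T *v (g *v u)) - (a * sympl v (T *v u) - b * sympl v u))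
     + (y * w) * (a * (2 * sympl v (T *v (g *v u)) - (a * sympl v (T *v u) - b * sympl v u))
       - b * (2 * sympl v (g *v u) - sympl v (T *v u)))" for x y z w
    by (simp add: p_def q_def s_def normalize n algebra_simps)
  show "s (p x y + q z w) = s (p x y) + s (q z w)"
    using s2[of x y z w] by (simp add: 1 diff_diff_eq)
  have t2: "t (p x y + q z w) - t (p x y) - t (q z w) =
     (x * z) * (2 * sympl v (T *v (g *v u)) - (a * sympl v (T *v u) - b * sympl v u))
     + (x * w + y * z) * (a * (2 * sympl v (T *v (g *v u)) - (a * sympl v (T *v u) - b * sympl v u))
       - b * (2 * sympl v (g *v u) - sympl v (T *v u)))
     + (y * w) * (a * (a * (2 * sympl v (T *v (g *v u)) - (a * sympl v (T *v u) - b * sympl v u))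
       - b * (2 * sympl v (g *v u) - sympl v (T *v u))) - b * (2 * sympl v (T *v (g *v u)) - (a * sympl v (T *v u) - b * sympl v u)))" for x y z w
    by (simp add: p_def q_def t_def normalize n algebra_simps)
  show "t (p x y + q z w) = t (p x y) + t (q z w)"
    using t2[of x y z w] by (simp add: 1 diff_diff_eq)
qed

text \<open>Let \<open>D = T\<^sup>2 - 4 l = (2 g - T)\<^sup>2\<close>. The vectors \<open>v\<close> and \<open>u0 = (2 g - T) v\<close> span orthogonal
  \<open>K\<close>-lines, so it suffices to find \<open>u = (x + y T) u0\<close> with \<open>s u = - s v\<close>, which exists as binary
  forms are universal. If by bad luck also \<open>t u = - t v\<close>, then \<open>D\<close> is a square in \<open>K\<close> and the plane
  spanned over \<open>K\<close> by \<open>v, u\<close> is hyperbolic: \<open>(1 + c) v + (1 - c) u\<close> has value \<open>4 c (s v, t v)\<close>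
  for each \<open>c\<close> in \<open>K\<close>, and \<open>c = t v - s v T\<close> works.\<close>

lemma ex_irreducible:
  assumes irr: "\<And>y. y * y - a * y + b \<noteq> 0" and ab: "a \<noteq> 0 \<or> b \<noteq> - 4 * l" and Hv: "H v \<noteq> 0"
  shows "\<exists>x. valid x \<and> simconj g (rep x)"
proof (cases "s v = 0")
  case True
  thus ?thesis using ex_cyclic Hv by (simp add: H_def)
next
  case False
  define u0 where "u0 = 2 *s (g *v v) - T *v v"
  have st0: "s u0 = (b + 4 * l) * s v - a * t v" "t u0 = (b + 4 * l) * t v - a * (a * t v - b * s v)"
    by (simp_all add: u0_def s_def t_def normalize algebra_simps)
  \<comment> \<open>The norm of D = a T - (b + 4 l), nonzero because K is a field here and D is
    nonzero by \<open>ab\<close>.\<close>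
  define N where "N = (b + 4 * l) * (b + 4 * l) - a * a * (b + 4 * l) + a * a * b"
  have "N \<noteq> 0"
  proof (cases "a = 0")
    case True
    thus ?thesis using ab by (simp add: N_def eq_neg_iff_add_eq_0)
  next
    case False
    have "N = a * a * (((b + 4 * l) / a) * ((b + 4 * l) / a) - a * ((b + 4 * l) / a) + b)"
      using False by (simp add: N_def field_simps)
    thus ?thesis using irr[of "(b + 4 * l) / a"] False by simp
  qed
  have "t u0 * t u0 - s u0 * (a * t u0 - b * s u0) = N * H v"
    by (simp add: st0 N_def H_def algebra_simps)
  hence "t u0 * t u0 - s u0 * (a * t u0 - b * s u0) \<noteq> 0" using \<open>N \<noteq> 0\<close> Hv by simp
  then obtain x y where "s u0 * (x * x) + 2 * t u0 * (x * y) + (a * t u0 - b * s u0) * (y * y) = - s v"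
    using binary_form_universal[OF _ two] by metis
  define u where "u = x *s u0 + y *s (T *v u0)"
  have su: "s u = - s v"
    unfolding u_def st_T using \<open>_ = - s v\<close> by (simp add: algebra_simps)
  have orth: "sympl v (2 *s (g *v u) - T *v u) = 0" "sympl (T *v v) (2 *s (g *v u) - T *v u) = 0"
    by (simp_all only: u_def u0_def normalize) (simp_all add: algebra_simps)
  note add = st_add[OF orth]
  show ?thesis
  proof (cases "t u = - t v")
    case False
    have "s (v + u) = 0" "t (v + u) \<noteq> 0"
      using add[of 1 0 1 0] su False by (simp_all add: add_eq_0_iff)
    thus ?thesis by (rule ex_cyclic)
  next
    case True
    define w where "w = ((1 + t v) *s v + (- s v) *s (T *v v)) + ((1 - t v) *s u + s v *s (T *v u))"
    have "s w = 0" "t w = 4 * H v"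
      unfolding w_def add st_T su True by (simp_all add: H_def algebra_simps)
    thus ?thesis using ex_cyclic Hv four_nonzero by simp
  qed
qed

subsection \<open>Split trace polynomial\<close>

lemma eigenspaces_orthogonal:
  assumes "T *v u = y *s u" "T *v v = z *s v" "y \<noteq> z"
  shows "sympl u v = 0"
  using T_selfadj[of u v] assms by (simp add: sympl_linear)

lemma eigenspace_T_invariant:
  assumes "T *v v = y *s v"
  shows "T *v (g *v v) = y *s (g *v v)" "t v = y * s v"
proof -
  show "T *v (g *v v) = y *s (g *v v)"
    using g_T[of v] assms by (simp add: vector_scalar_commute)
  thus "t v = y * s v" by (simp add: t_def s_def sympl_linear)
qed

lemma st_eigen_add:
  assumes "T *v u = y *s u" "T *v v = z *s v" "y \<noteq> z"
  shows "s (u + v) = s u + s v" "t (u + v) = y * s u + z * s v"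
  using assms eigenspace_T_invariant(1)[of u y] eigenspace_T_invariant(1)[of v z]
    eigenspaces_orthogonal[of u y "g *v v" z] eigenspaces_orthogonal[of v z "g *v u" y]
  by (simp_all add: s_def t_def matrix_vector_right_distrib sympl_linear)

lemma eigenvector_diff:
  assumes "a = y + z" "b = y * z"
  shows "T *v (T *v v - z *s v) = y *s (T *v v - z *s v)"
    "s (T *v v - z *s v) = (y - z) * (t v - z * s v)"
proof -
  show "T *v (T *v v - z *s v) = y *s (T *v v - z *s v)"
    by (simp add: normalize assms vec_eq_iff algebra_simps)
  show "s (T *v v - z *s v) = (y - z) * (t v - z * s v)"
    using st_T(1)[of "- z" v 1] by (simp add: assms algebra_simps vec_eq_iff)
qed

text \<open>On the span of \<open>v\<close> and \<open>g *v v\<close> the form \<open>s\<close> is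
  nondegenerate because z^2 differs from 4 l. It therefore takes the value \<open>- s u\<close>,
  cancelling \<open>s u\<close> while \<open>t\<close> survives.\<close>

lemma ex_split_cyclic:
  assumes "T *v u = y *s u" "T *v v = z *s v" "y \<noteq> z" "s u \<noteq> 0" "s v \<noteq> 0" "z * z \<noteq> 4 * l"
  shows "\<exists>x. valid x \<and> simconj g (rep x)"
proof -
  let ?d = "(s v * z / 2) * (s v * z / 2) - s v * (s v * l)"
  have "4 * ?d = s v * s v * (z * z - 4 * l)" using two four_nonzero by (simp add: field_simps)
  hence "?d \<noteq> 0" using assms(5,6) by (metis mult_eq_0_iff right_minus_eq)
  then obtain p q where pq: "s v * (p * p) + 2 * (s v * z / 2) * (p * q) + (s v * l) * (q * q) = - s u"
    using binary_form_universal[OF _ two] by metis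
  define v' where "v' = p *s v + q *s (g *v v)"
  have Tv': "T *v v' = z *s v'"
    using eigenspace_T_invariant(1)[OF assms(2)]
    by (simp add: v'_def matrix_vector_right_distrib vector_scalar_commute assms(2) vector_add_ldistrib vector_smult_assoc mult.commute)
  have "s v' = s v * (p * p) + s v * z * (p * q) + (s v * l) * (q * q)"
    by (simp add: v'_def s_def normalize assms(2) eigenspace_T_invariant(1)[OF assms(2)] algebra_simps)
  hence sv': "s v' = - s u" using pq two by simp
  have "s (u + v') = 0" "t (u + v') = (y - z) * s u"
    using st_eigen_add[OF assms(1) Tv' assms(3)] sv' by (simp_all add: algebra_simps)
  thus ?thesis using ex_cyclic assms(3,4) by simp
qed

text \<open>Polarizing \<open>s = 0\<close> makes 2 g v - y v orthogonal to the eigenspace of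
  \<open>y\<close>; the other eigenspace is orthogonal anyway, and the two span.\<close>

lemma eigenspace_scalar:
  assumes ab: "a = y + z" "b = y * z" "y \<noteq> z"
    and iso: "\<And>u. T *v u = y *s u \<Longrightarrow> s u = 0" and v: "T *v v = y *s v"
  shows "2 *s (g *v v) = y *s v"
proof (rule sympl_ext)
  have 1: "sympl u (2 *s (g *v v)) = sympl u (y *s v)" if u: "T *v u = y *s u" for u
  proof -
    have "T *v (u + v) = y *s (u + v)" using u v by (simp add: matrix_vector_right_distrib vector_add_ldistrib)
    hence "s (u + v) = 0" "s u = 0" "s v = 0" using iso u v by blast+
    moreover have "sympl v (g *v u) = sympl u (g *v v) - y * sympl u v"
      using sympl_swap[of v "g *v u"] by (simp add: g_skew v sympl_linear)
    ultimately show ?thesis by (simp add: s_def matrix_vector_right_distrib sympl_linear algebra_simps)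
  qed
  fix u
  let ?u1 = "T *v u - z *s u" and ?u2 = "T *v u - y *s u"
  have u12: "T *v ?u1 = y *s ?u1" "T *v ?u2 = z *s ?u2"
    using eigenvector_diff(1)[of y z u] eigenvector_diff(1)[of z y u] ab by (simp_all add: algebra_simps)
  have "sympl ?u2 (g *v v) = 0" "sympl ?u2 v = 0"
    using eigenspaces_orthogonal[OF u12(2)] eigenspace_T_invariant(1)[OF v] v ab(3) by auto
  hence 2: "sympl ?u2 (2 *s (g *v v)) = sympl ?u2 (y *s v)" by (simp add: sympl_linear)
  have "(y - z) * sympl u w = sympl ?u1 w - sympl ?u2 w" for w
    by (simp add: sympl_linear algebra_simps)
  hence "(y - z) * sympl u (2 *s (g *v v)) = (y - z) * sympl u (y *s v)"
    using 1[OF u12(1)] 2 by simp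
  thus "sympl u (2 *s (g *v v)) = sympl u (y *s v)" using ab(3) by simp
qed

text \<open>On the eigenspace of \<open>y\<close>, g is the scalar y / 2, which forces l = (y /
  2)^2. A symplectic pair there is combined with the orthogonal pair \<open>e\<close>,
  \<open>g *v e\<close>.\<close>

lemma ex_cubic:
  assumes ab: "a = y + z" "b = y * z" "y \<noteq> z"
    and scalar: "\<And>v. T *v v = y *s v \<Longrightarrow> 2 *s (g *v v) = y *s v"
    and nz: "T *v u \<noteq> z *s u" and e: "T *v e = z *s e" "s e \<noteq> 0"
  shows "\<exists>x. valid x \<and> simconj g (rep x)"
proof -
  define m where "m = y / 2"
  have ym: "y = 2 * m" using two by (simp add: m_def)
  have gm: "g *v v = m *s v" if "T *v v = y *s v" for v
    using scalar[OF that] two by (simp add: ym vec_eq_iff)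
  define f1 where "f1 = T *v u - z *s u"
  have f1: "T *v f1 = y *s f1" "f1 \<noteq> 0"
    using eigenvector_diff(1)[OF ab(1,2)] nz by (simp_all add: f1_def)
  have "g *v (g *v f1) = T *v (g *v f1) - l *s f1" by (rule g_square)
  hence "(m * m) *s f1 = (2 * m * m - l) *s f1"
    using f1 gm[OF f1(1)] by (simp add: vector_scalar_commute ym vec_eq_iff algebra_simps)
  hence lm: "l = m * m"
    using f1(2) by (simp add: vector_mul_rcancel)
  obtain w where w: "sympl w f1 = - (s e)" using sympl_partner[OF f1(2)] by blast
  define f2 where "f2 = (1 / (y - z)) *s (T *v w - z *s w)"
  have f2: "T *v f2 = y *s f2"
    using eigenvector_diff(1)[OF ab(1,2), of w]
    by (simp add: f2_def vector_scalar_commute vector_smult_assoc mult.commute)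
  have f12: "sympl f1 f2 = s e"
  proof -
    have "sympl f1 (T *v w) = y * sympl f1 w"
      using f1(1) T_selfadj[of f1 w] by (simp add: sympl_linear)
    thus ?thesis using w sympl_swap[of f1 w] ab(3) by (simp add: f2_def sympl_linear flip: left_diff_distrib)
  qed
  have orth: "sympl e f = 0" "sympl f (g *v e) = 0" if "T *v f = y *s f" for f
    using eigenspaces_orthogonal[OF e(1) that] eigenspaces_orthogonal[OF that eigenspace_T_invariant(1)[OF e(1)]] ab(3)
    by auto
  have "simconj g (cubic_form m z)"
    by (rule symplectic_basis_simconj[where ?v1.0 = e and ?v2.0 = f1 and ?v3.0 = f2 and ?v4.0 = "g *v e" and c = "s e"])
      (use e f12 orth[OF f1(1)] orth[OF f2] in \<open>simp_all add: s_def[symmetric] cubic_form_def gm[OF f1(1)] gm[OF f2]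
        g_square eigenspace_T_invariant(1)[OF e(1)] lm vec_eq_iff\<close>)
  moreover have "valid (Cubic m z)"
    using lm l_nonzero ab(3) ym by auto
  ultimately show ?thesis by (intro exI[of _ "Cubic m z"]) simp
qed

text \<open>Polarizing \<open>s = 0\<close> gives 2 g = T, so g is self-adjoint with g^2 = l.
  Vectors \<open>u\<close>, \<open>v\<close> as needed for the basis exist unless g is
  scalar.\<close>

lemma ex_root:
  assumes s0: "\<And>v. s v = 0" and nonscalar: "\<not> (\<exists>y. \<forall>v. T *v v = y *s v)"
  shows "\<exists>x. valid x \<and> simconj g (rep x)"
proof -
  have gT: "2 *s (g *v v) = T *v v" for v
  proof (rule sympl_ext)
    fix u
    have "sympl v (g *v u) = sympl u (g *v v) - sympl u (T *v v)"
      using sympl_swap[of v "g *v u"] by (simp add: g_skew)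
    hence "2 * sympl u (g *v v) - sympl u (T *v v) = sympl u (g *v v) + sympl v (g *v u)"
      by simp
    also have "\<dots> = s (u + v) - s u - s v"
      by (simp add: s_def matrix_vector_right_distrib sympl_linear)
    finally show "sympl u (2 *s (g *v v)) = sympl u (T *v v)"
      using s0 by (simp add: sympl_linear)
  qed
  have self: "sympl (g *v u) v = sympl u (g *v v)" for u v
    by (simp add: g_skew sympl_linear flip: gT)
  have gg: "g *v (g *v v) = l *s v" for v
  proof -
    have "g *v (g *v v) = 2 *s (g *v (g *v v)) - l *s v"
      by (subst gT) (rule g_square)
    thus ?thesis by (simp add: vec_eq_iff)
  qed
  obtain u v where uv: "sympl u v = 0" "sympl u (g *v v) \<noteq> 0"
  proof (rule ccontr)
    assume "\<not> thesis"
    with that have *: "sympl u v = 0 \<Longrightarrow> sympl u (g *v v) = 0" for u v by blast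
    \<comment> \<open>Coordinates are pairings with fixed vectors, so \<open>*\<close> kills the
      off-diagonal entries of g and equates the diagonal ones.\<close>
    have "\<exists>u. \<forall>x :: 'a ^ 4. sympl u x = x $ i" for i
    proof -
      have ax: "sympl (- axis 4 1) x = x $ 1" "sympl (- axis 3 1) x = x $ 2"
        "sympl (axis 2 1) x = x $ 3" "sympl (axis 1 1) x = x $ 4" for x :: "'a ^ 4"
        by (simp_all add: sympl_def axis_def)
      consider "i = 1" | "i = 2" | "i = 3" | "i = 4" using exhaust_4[of i] by blast
      thus ?thesis
        by cases (use ax in blast)+
    qed
    then obtain dual where dual: "\<And>i (x :: 'a ^ 4). sympl (dual i) x = x $ i" by metis
    have ga: "(g *v axis j 1) $ i = g $ i $ j" for i j
      by (simp add: matrix_vector_mult_def axis_def if_distrib[of "\<lambda>x. _ * x"] cong: if_cong)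
    have d: "g $ i $ j = 0" if "i \<noteq> j" for i j
      using *[of "dual i" "axis j 1"] that by (simp add: dual ga) (simp add: axis_def)
    have k: "g $ i $ i = g $ 1 $ 1" for i
      using *[of "dual i - dual 1" "axis i 1 + axis 1 1"] d[of i 1] d[of 1 i]
      by (cases "i = 1") (simp_all add: sympl_linear matrix_vector_right_distrib dual ga, simp add: axis_def)
    have "g *v v = g $ 1 $ 1 *s v" for v
      by (rule vec_4_eqI) (simp_all add: matrix_vector_mult_def sum_4 d k[of 2] k[of 3] k[of 4])
    hence "\<forall>v. T *v v = (2 * g $ 1 $ 1) *s v"
      by (simp add: vector_smult_assoc flip: gT)
    thus False using nonscalar by blast
  qed
  have "simconj g (root_form l 0 0)"
  proof (rule symplectic_basis_simconj[where ?v1.0 = u and ?v2.0 = "g *v u" and ?v3.0 = v and ?v4.0 = "g *v v" and c = "sympl u (g *v v)"])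
    show "sympl u (g *v u) = 0" "sympl v (g *v v) = 0" using s0 by (simp_all add: s_def)
  qed (use uv in \<open>simp_all add: self gg root_form_def sympl_linear\<close>)
  thus ?thesis using l_nonzero by (intro exI[of _ "Root l"]) simp
qed

text \<open>If \<open>R = T - m\<close> is nonzero, then its rank is 2 because \<open>B(u, R v)\<close> is alternating,
  so the kernel of \<open>R\<close> is its image. Polarizing \<open>H = 0\<close> gives \<open>R (g - m / 2) = 0\<close>, hence
  \<open>(g - m / 2)\<^sup>2 = 0\<close>; but \<open>(g - m / 2)\<^sup>2\<close> equals \<open>(m / 2) R\<close>.\<close>

lemma double_root_scalar:
  assumes ab: "a = 2 * m" "b = m * m" and H0: "\<And>v. H v = 0"
  shows "T *v v = m *s v"
proof (rule ccontr)
  assume nz: "T *v v \<noteq> m *s v"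
  define R where "R = (\<lambda>v. T *v v - m *s v)"
  have R_adj: "sympl (R u) v = sympl u (R v)" for u v
    by (simp add: R_def sympl_linear T_selfadj)
  have R_alt: "sympl u (R u) = 0" for u
    by (simp add: R_def sympl_linear T_alt)
  have RT: "R (T *v v) = m *s R v" for v
    by (simp add: R_def normalize ab vec_eq_iff algebra_simps)
  have TR: "T *v R v = m *s R v" for v
    by (simp add: R_def normalize ab vec_eq_iff algebra_simps)
  have R_lin: "R (u + v) = R u + R v" "R (u - v) = R u - R v" "R (c *s v) = c *s R v" for u v c
    by (simp_all add: R_def normalize vec_eq_iff algebra_simps)
  have RR: "R (R v) = 0" for v
    by (simp add: R_def normalize ab vec_eq_iff algebra_simps)
  have gR: "g *v R v = R (g *v v)" for v
    by (simp add: R_def normalize)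
  define h where "h = m / 2"
  have mh: "m = 2 * h" using two by (simp add: h_def)
  have Rg: "R (g *v v) = h *s R v" for v
  proof (rule sympl_ext)
    fix u
    have q: "sympl u (R (g *v u)) = 0" for u
    proof -
      have "H u = (t u - m * s u) * (t u - m * s u)" unfolding H_def by (simp add: ab algebra_simps)
      hence "t u = m * s u" using H0 by simp
      thus ?thesis by (simp add: R_def s_def t_def sympl_linear)
    qed
    have "sympl v (R (g *v u)) = sympl u (R (g *v v)) - m * sympl u (R v)"
    proof -
      have "sympl v (R (g *v u)) = - sympl (g *v u) (R v)"
        by (metis R_adj sympl_swap)
      thus ?thesis by (simp add: g_skew TR gR sympl_linear)
    qed
    moreover have "sympl u (R (g *v v)) + sympl v (R (g *v u)) = 0"
      using q[of "u + v"] q[of u] q[of v]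
      by (simp add: matrix_vector_right_distrib R_lin sympl_linear add.commute)
    ultimately have "sympl u (R (g *v v)) + (sympl u (R (g *v v)) - m * sympl u (R v)) = 0"
      by simp
    hence "2 * sympl u (R (g *v v)) = 2 * (h * sympl u (R v))"
      by (simp add: mh algebra_simps)
    thus "sympl u (R (g *v v)) = sympl u (h *s R v)"
      using two by (simp add: sympl_linear)
  qed
  have R0: "R v \<noteq> 0" using nz by (simp add: R_def)
  have "l *s R v = R (g *v (adj g *v v))"
    by (simp add: similitude_adj[OF sim] R_lin)
  also have "\<dots> = h *s (R (T *v v) - R (g *v v))"
    by (simp add: Rg T_mult R_lin)
  also have "\<dots> = (h * h) *s R v"
    by (simp add: RT Rg mh vec_eq_iff algebra_simps)
  finally have l: "l = h * h" using R0 by simp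
  hence h: "h \<noteq> 0" using l_nonzero by auto
  define w where "w = g *v v - h *s v"
  have Rw: "R w = 0" by (simp add: w_def R_lin Rg)
  have gw: "g *v w - h *s w = h *s R v"
  proof -
    have "g *v w - h *s w = g *v R v"
      by (simp add: w_def R_def normalize l mh vec_eq_iff algebra_simps)
    thus ?thesis by (simp add: gR Rg)
  qed
  obtain x where x: "sympl x (R v) = 1" using sympl_partner[OF R0] by blast
  have vx: "sympl v (R x) = -1" using x sympl_swap[of "R v" x] by (simp add: R_adj[symmetric])
  \<comment> \<open>Orthogonality to a symplectic basis made from \<open>v\<close>, \<open>x\<close>
    and their images under \<open>R\<close> shows \<open>w' = 0\<close>, so \<open>w\<close> lies in
    the image of \<open>R\<close>.\<close>
  define w' where "w' = w - sympl x w *s R v + sympl v w *s R x"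
  have "w' = 0"
  proof (rule symplectic_basis_nondegenerate[where ?v1.0 = "v + sympl v x *s R v" and ?v2.0 = x
        and ?v3.0 = "R v" and ?v4.0 = "- R x" and c = 1])
    show "sympl (v + sympl v x *s R v) x = 0"
      using x sympl_swap[of "R v" x] by (simp add: sympl_linear)
  qed (simp_all add: sympl_linear x vx R_alt w'_def R_adj RR Rw R_lin)
  hence "w = sympl x w *s R v - sympl v w *s R x"
    by (simp add: w'_def vec_eq_iff algebra_simps eq_neg_iff_add_eq_0)
  then obtain p r where w: "w = p *s R v - r *s R x" by blast
  have "g *v R v = h *s R v" for v by (simp only: gR Rg)
  hence "g *v w = h *s w"
    unfolding w by (simp add: matrix_vector_mult_diff_distrib vector_scalar_commute vec_eq_iff algebra_simps)
  thus False using gw h R0 by simp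
qed

text \<open>An eigenspace on which \<open>s\<close> vanishes leads to \<open>Cubic\<close> or
  \<open>Root\<close>. Otherwise \<open>ex_split_cyclic\<close> applies unless y^2 = z^2 = 4 l, and
  then the square class of a nonzero value of \<open>H\<close> decides.\<close>

lemma ex_distinct_roots:
  assumes ab: "a = y + z" "b = y * z" "y \<noteq> z" and nonscalar: "\<not> (\<exists>y. \<forall>v. T *v v = y *s v)"
  shows "\<exists>x. valid x \<and> simconj g (rep x)"
proof -
  have half: ?thesis
    if ab: "a = y + z" "b = y * z" "y \<noteq> z" and iso: "\<And>u. T *v u = y *s u \<Longrightarrow> s u = 0" for y z
  proof (cases "\<exists>e. T *v e = z *s e \<and> s e \<noteq> 0")
    case True
    thus ?thesis using ex_cubic[OF ab eigenspace_scalar[OF ab iso]] nonscalar by blast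
  next
    case False
    have "s v = 0" for v
    proof -
      have "(y - z) * (t v - z * s v) = 0" "(z - y) * (t v - y * s v) = 0"
        using eigenvector_diff[of y z v] eigenvector_diff[of z y v] ab iso False
        by (auto simp: add.commute mult.commute)
      hence "t v = z * s v" "t v = y * s v" using ab(3) by auto
      thus ?thesis using ab(3) by auto
    qed
    thus ?thesis by (rule ex_root[OF _ nonscalar])
  qed
  show ?thesis
  proof (cases "(\<exists>u. T *v u = y *s u \<and> s u \<noteq> 0) \<and> (\<exists>v. T *v v = z *s v \<and> s v \<noteq> 0)")
    case False
    thus ?thesis using half[of y z] half[of z y] ab by (auto simp: add.commute mult.commute)
  next
    case True
    then obtain u v where u: "T *v u = y *s u" "s u \<noteq> 0" and v: "T *v v = z *s v" "s v \<noteq> 0" by blast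
    show ?thesis
    proof (cases "y * y = 4 * l \<and> z * z = 4 * l")
      case False
      thus ?thesis
        using ex_split_cyclic[OF u(1) v(1) ab(3) u(2) v(2)]
          ex_split_cyclic[OF v(1) u(1) ab(3)[symmetric] v(2) u(2)] by blast
    next
      case yz: True
      hence "z = - y" using ab(3) by (metis square_eq_iff)
      hence a0: "a = 0" "b = - 4 * l" using ab yz by simp_all
      have "H (u + v) = - ((y - z) * (y - z) * (s u * s v))"
        unfolding H_def st_eigen_add[OF u(1) v(1) ab(3)] by (simp add: ab algebra_simps)
      hence "H (u + v) \<noteq> 0" using u v ab(3) by simp
      thus ?thesis using ex_cyclic_square ex_twisted[OF a0] by blast
    qed
  qed
qed

section \<open>Combining the cases\<close>

lemma ex_nonscalar:
  assumes nonscalar: "\<not> (\<exists>y. \<forall>v. T *v v = y *s v)"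
  shows "\<exists>x. valid x \<and> simconj g (rep x)"
proof (cases "\<exists>y. y * y - a * y + b = 0")
  case True
  then obtain y where y: "y * y - a * y + b = 0" by blast
  define z where "z = a - y"
  have "y * z = b - (y * y - a * y + b)" by (simp add: z_def algebra_simps)
  hence ab: "a = y + z" "b = y * z" using y by (simp_all add: z_def)
  show ?thesis
  proof (cases "y = z")
    case False
    thus ?thesis using ex_distinct_roots ab nonscalar by blast
  next
    case True
    hence ab': "a = 2 * y" "b = y * y" using ab by simp_all
    then obtain v where "H v \<noteq> 0" using double_root_scalar nonscalar by blast
    moreover have "H v = (t v - y * s v) * (t v - y * s v)"
      unfolding H_def by (simp add: ab' algebra_simps)
    ultimately show ?thesis using ex_cyclic_square unfolding is_square_def by blast
  qed
next
  case False
  show ?thesis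
  proof (cases "\<exists>v. H v \<noteq> 0")
    case True
    thus ?thesis
      using ex_irreducible ex_cyclic_square ex_twisted False by (cases "a = 0 \<and> b = - 4 * l") blast+
  next
    case H: False
    have "s v = 0" for v
    proof (rule ccontr)
      assume "s v \<noteq> 0"
      \<comment> \<open>For nonzero \<open>s v\<close>, \<open>H v\<close> is a square times the
        value of the irreducible polynomial at t / s.\<close>
      hence "H v = s v * s v * ((t v / s v) * (t v / s v) - a * (t v / s v) + b)"
        by (simp add: H_def field_simps)
      moreover have "H v = 0" using H by blast
      ultimately have "(t v / s v) * (t v / s v) - a * (t v / s v) + b = 0"
        using \<open>s v \<noteq> 0\<close> by (metis mult_eq_0_iff)
      thus False using False by blast
    qed
    thus ?thesis by (rule ex_root[OF _ nonscalar])
  qed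
qed

end

lemma similitude_ex_rep:
  fixes g :: "'a::{field,finite} ^ 4 ^ 4"
  assumes sim: "similitude g l" and two: "(2::'a) \<noteq> 0"
  shows "\<exists>x. valid x \<and> simconj g (rep x)"
proof -
  define T where "T = g + adj g"
  have "adj T = T" by (simp add: T_def adj_add add.commute)
  then obtain a b where "\<And>v. T *v (T *v v) = a *s (T *v v) - b *s v"
    using self_adjoint_quadratic two by blast
  then interpret similitude_trace g T l a b
    using sim two by unfold_locales (auto simp: T_def)
  show ?thesis
  proof (cases "\<exists>y. \<forall>v. T *v v = y *s v")
    case False
    thus ?thesis by (rule ex_nonscalar)
  next
    case True
    then obtain y where y: "\<And>v. T *v v = y *s v" by blast
    define h where "h = y / 2"
    have yh: "y = 2 * h" using two by (simp add: h_def)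
    define N where "N = g - mat h"
    have N: "N *v v = g *v v - h *s v" for v
      by (simp add: N_def matrix_vector_mult_diff_rdistrib mat_vector_mult)
    interpret N: skew_square N "h * h - l"
    proof
      show "sympl (N *v u) v = - sympl u (N *v v)" for u v
        by (simp add: N sympl_linear g_skew y yh algebra_simps)
      show "N *v (N *v v) = (h * h - l) *s v" for v
        by (simp add: N matrix_vector_mult_diff_distrib vector_scalar_commute g_square y yh vec_eq_iff algebra_simps)
      show "(2::'a) \<noteq> 0" by (rule two)
    qed
    show ?thesis
      by (rule N.ex_normal_form[of g h]) (use l_nonzero in \<open>simp_all add: N\<close>)
  qed
qed

theorem mainTheorem5:
  fixes q p n :: nat
  assumes "prime p" "odd p" "n \<ge> 1" "q = p ^ n"
    and "CARD('a::{field, finite}) = q"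
  shows "card (conjugacy_classes (GSp4 :: ('a ^ 4 ^ 4) monoid)) = (q\<^sup>2 + 2 * q + 4) * (q - 1)"
proof -
  have two: "(2::'a) \<noteq> 0" by (rule two_neq_zero) (use assms in simp)
  show ?thesis
    using card_conjugacy_classes_GSp4[OF two] similitude_ex_rep two assms(5) by blast
qed

end
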